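(* Let $t,n$ be positive integers. If $M$ is a simple rank-$n$ binary matroid with no $M(K_t)$-minor, then $|M| \le 2^{t^4/2}\cdot n$.
   Context: Matroids are finite. $|M|$ denotes the number of elements of $M$. $M(K_t)$ is the cycle matroid of the complete graph $K_t$ on $t$ vertices. "No $N$-minor" means no minor isomorphic to $N$. *)

theory Defs
  imports Complex_Main "HOL-Library.Z2"
begin

record 'a indep_system =
  ground :: "'a set"
  indep :: "'a set set"

locale matroid =
  fixes M :: "'a indep_system"
  assumes finite_ground: "finite (ground M)"
    and indep_subset_ground: "X \<in> indep M \<Longrightarrow> X \<subseteq> ground M"
    and indep_empty: "{} \<in> indep M"
    and indep_subset: "\<lbrakk>X \<in> indep M; Y \<subseteq> X\<rbrakk> \<Longrightarrow> Y \<in> indep M"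
    and indep_augment: "\<lbrakk>X \<in> indep M; Y \<in> indep M; card X < card Y\<rbrakk>
      \<Longrightarrow> \<exists>y \<in> Y - X. insert y X \<in> indep M"

definition basis_of :: "'a indep_system \<Rightarrow> 'a set \<Rightarrow> 'a set \<Rightarrow> bool" where
  "basis_of M X B \<longleftrightarrow>
     B \<in> indep M \<and> B \<subseteq> X \<and> (\<forall>B'. B' \<in> indep M \<and> B \<subseteq> B' \<and> B' \<subseteq> X \<longrightarrow> B' = B)"

definition mrank :: "'a indep_system \<Rightarrow> nat" where
  "mrank M = Max (card ` indep M)"

definition circuit :: "'a indep_system \<Rightarrow> 'a set \<Rightarrow> bool" where
  "circuit M X \<longleftrightarrow> X \<subseteq> ground M \<and> X \<notin> indep M \<and> (\<forall>Y. Y \<subset> X \<longrightarrow> Y \<in> indep M)"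

text \<open>Circuits of size one are loops, circuits of size two are pairs of parallel elements.\<close>

definition simple_matroid :: "'a indep_system \<Rightarrow> bool" where
  "simple_matroid M \<longleftrightarrow> (\<forall>X. circuit M X \<longrightarrow> card X \<noteq> 1 \<and> card X \<noteq> 2)"

text \<open>Linear independence over \<open>GF(2)\<close> of the family of columns of \<open>A\<close> indexed by \<open>X\<close>, where
  \<open>A i e\<close> is the entry in row \<open>i < m\<close> and column \<open>e\<close>.  Independence is that of an indexed family:
  two equal columns with different indices are dependent.\<close>

definition columns_independent :: "nat \<Rightarrow> (nat \<Rightarrow> 'a \<Rightarrow> bit) \<Rightarrow> 'a set \<Rightarrow> bool" where
  "columns_independent m A X \<longleftrightarrow>
     (\<forall>c. (\<forall>i<m. (\<Sum>e\<in>X. c e * A i e) = 0) \<longrightarrow> (\<forall>e\<in>X. c e = 0))"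

definition binary_matroid :: "'a indep_system \<Rightarrow> bool" where
  "binary_matroid M \<longleftrightarrow>
     (\<exists>m A. \<forall>X \<subseteq> ground M. X \<in> indep M \<longleftrightarrow> columns_independent m A X)"

definition delete :: "'a indep_system \<Rightarrow> 'a set \<Rightarrow> 'a indep_system" where
  "delete M D = \<lparr>ground = ground M - D, indep = {X \<in> indep M. X \<inter> D = {}}\<rparr>"

definition contract :: "'a indep_system \<Rightarrow> 'a set \<Rightarrow> 'a indep_system" where
  "contract M C = \<lparr>ground = ground M - C,
     indep = {X. X \<subseteq> ground M - C \<and> (\<exists>B. basis_of M C B \<and> X \<union> B \<in> indep M)}\<rparr>"

definition isomorphic :: "'a indep_system \<Rightarrow> 'b indep_system \<Rightarrow> bool" where
  "isomorphic M N \<longleftrightarrow>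
     (\<exists>f. bij_betw f (ground M) (ground N) \<and>
          (\<forall>X \<subseteq> ground M. X \<in> indep M \<longleftrightarrow> f ` X \<in> indep N))"

definition has_minor :: "'a indep_system \<Rightarrow> 'b indep_system \<Rightarrow> bool" where
  "has_minor M N \<longleftrightarrow>
     (\<exists>C D. C \<subseteq> ground M \<and> D \<subseteq> ground M \<and> C \<inter> D = {} \<and>
            isomorphic (delete (contract M C) D) N)"

text \<open>A simple graph is given by its set of edges, each a two-element set of vertices; a cycle has
  at least three vertices, listed in cyclic order.\<close>

definition cycle_edges :: "'v list \<Rightarrow> 'v set set" where
  "cycle_edges vs = {{vs ! i, vs ! (Suc i mod length vs)} | i. i < length vs}"

definition is_cycle :: "'v set set \<Rightarrow> bool" where
  "is_cycle Z \<longleftrightarrow> (\<exists>vs. distinct vs \<and> length vs \<ge> 3 \<and> Z = cycle_edges vs)"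

definition cycle_matroid :: "'v set set \<Rightarrow> 'v set indep_system" where
  "cycle_matroid E = \<lparr>ground = E, indep = {X. X \<subseteq> E \<and> (\<nexists>Z. is_cycle Z \<and> Z \<subseteq> X)}\<rparr>"

definition complete_graph_edges :: "nat \<Rightarrow> nat set set" where
  "complete_graph_edges t = {{u, v} | u v. u < t \<and> v < t \<and> u \<noteq> v}"

end

theory Submission
  imports Defs "HOL-Computational_Algebra.Polynomial"
begin

text \<open>
  Let \<open>S\<close> be a set of non-zero vectors representing a matroid of large density, and write
  \<open>x \<sim> y\<close> if \<open>x + y \<in> S\<close>. Contracting elements as long as this does not
  decrease the density, every element ends up in many triangles, so that this graph has large average
  degree on \<open>S\<close>. Suppose now that the graph with colours \<open>x + y \<in> R\<close> is dense on
  a set \<open>T\<close>; a random hyperplane separates \<open>T\<close> from \<open>R\<close> at the cost of a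
  constant factor. Contract colours as long as this preserves the average degree. When a colour
  \<open>e\<close> cannot be contracted, many edges are lost because they join vertices that both belong to
  a pair \<open>q\<close>, \<open>q + e\<close> or because they lie in a triangle with such a pair. In the first case,
  for some \<open>e\<close>, the graph is dense on these pairs modulo \<open>e\<close>; in the second case, for all
  \<open>e\<close>, there are so many triangles that the graph is dense on the neighbourhood of some vertex
  \<open>z\<close>, which is taken modulo \<open>z\<close>. Either way the average degree drops by a constant factor,
  and every remaining vertex has one more independent preimage in \<open>S\<close>.

  After \<open>t - 1\<close> rounds, the many remaining vertices have \<open>t\<close> affinely independent
  preimages each, and by the pigeonhole principle \<open>t choose 2\<close> independent ones among them have
  the same differences \<open>w u + w v\<close>. These vertices are assigned to the pairs
  \<open>u\<close>, \<open>v\<close>: contracting one of the corresponding two preimages turns the other one into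
  \<open>w u + w v\<close>, and these vectors represent \<open>M(K\<^sub>t)\<close>.
\<close>

section \<open>Vectors and contractions over \<open>GF(2)\<close>\<close>

text \<open>Polynomials serve as finitely supported vectors; their multiplication plays no role.\<close>

type_synonym vec = "bit poly"

lemma bit_add_self [simp]: "(b::bit) + b = 0"
  by (cases b) auto

lemma vec_add_self [simp]: "(x::vec) + x = 0"
  unfolding poly_eq_iff coeff_add bit_add_self by simp

lemma vec_add_self_left [simp]: "(x::vec) + (x + y) = y"
  by (simp flip: add.assoc)

lemma vec_add_cancel: "(y::vec) + (x + y) = x"
  by (metis add.commute vec_add_self_left)

lemma vec_uminus [simp]: "- (x::vec) = x"
  by (metis add.inverse_unique vec_add_self)

lemma vec_add_eq_0_iff [simp]: "(x::vec) + y = 0 \<longleftrightarrow> x = y"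
  by (metis add_eq_0_iff vec_uminus)

lemma vec_add_eq_iff: "(x::vec) + y = z \<longleftrightarrow> x = y + z"
  by (metis vec_add_self_left add.commute)

section \<open>Spans and independence over GF(2)\<close>

inductive_set vspan :: "vec set \<Rightarrow> vec set" for X where
  vspan_zero: "0 \<in> vspan X"
| vspan_step: "x \<in> X \<Longrightarrow> y \<in> vspan X \<Longrightarrow> x + y \<in> vspan X"

lemma vspan_base: "x \<in> X \<Longrightarrow> x \<in> vspan X"
  using vspan_step[OF _ vspan_zero] by auto

lemma vspan_add:
  assumes "x \<in> vspan X" "y \<in> vspan X" shows "x + y \<in> vspan X"
  using assms(1)
proof induction
  case (vspan_step x y)
  then show ?case by (simp add: add.assoc vspan.vspan_step)
qed (simp add: assms)

lemma vspan_least: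
  assumes "X \<subseteq> vspan Y" shows "vspan X \<subseteq> vspan Y"
proof
  fix x assume "x \<in> vspan X"
  then show "x \<in> vspan Y"
    by induction (use assms vspan_zero vspan_add in blast)+
qed

lemma vspan_mono: "X \<subseteq> Y \<Longrightarrow> vspan X \<subseteq> vspan Y"
  by (rule vspan_least) (auto intro: vspan_base)

lemma vspan_empty [simp]: "vspan {} = {0}"
  by (auto elim: vspan.cases intro: vspan_zero)

lemma vspan_insert:
  assumes "x \<in> vspan (insert a X)" shows "x \<in> vspan X \<or> x + a \<in> vspan X"
  using assms
proof induction
  case (vspan_step x y)
  then show ?case
    using vspan.vspan_step[of x X y] vspan.vspan_step[of x X "y + a"]
    by (auto simp: add_ac)
qed (simp add: vspan_zero)

lemma finite_card_vspan:
  "finite X \<Longrightarrow> finite (vspan X) \<and> card (vspan X) \<le> 2 ^ card X"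
proof (induction X rule: finite_induct)
  case (insert a X)
  have sub: "vspan (insert a X) \<subseteq> vspan X \<union> (\<lambda>x. x + a) ` vspan X"
  proof
    fix x assume "x \<in> vspan (insert a X)"
    from vspan_insert[OF this] show "x \<in> vspan X \<union> (\<lambda>x. x + a) ` vspan X"
      proof
      assume "x + a \<in> vspan X"
      then have "(x + a) + a \<in> (\<lambda>x. x + a) ` vspan X" by (rule imageI)
      then show ?thesis by (simp add: add.assoc)
    qed simp
  qed
  have fin: "finite (vspan X \<union> (\<lambda>x. x + a) ` vspan X)"
    using insert by auto
  have "card (vspan (insert a X)) \<le> card (vspan X) + card ((\<lambda>x. x + a) ` vspan X)"
    using card_mono[OF fin sub] card_Un_le order_trans by blast
  also have "\<dots> \<le> 2 ^ card X + 2 ^ card X"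
    using insert card_image_le[of "vspan X" "\<lambda>x. x + a"] by simp
  finally show ?case
    using insert finite_subset[OF sub fin] by simp
qed simp

text \<open>Coefficients over GF(2) are 0 or 1, so linear combinations are subset sums: adding a
  generator that already occurs cancels it.\<close>

lemma vspan_image_sum:
  assumes "finite C" "x \<in> vspan (v ` C)"
  obtains Y where "Y \<subseteq> C" "x = (\<Sum>y\<in>Y. v y)"
proof -
  from assms(2) have "\<exists>Y\<subseteq>C. x = (\<Sum>y\<in>Y. v y)"
  proof induction
    case vspan_zero
    show ?case by (rule exI[of _ "{}"]) simp
  next
    case (vspan_step x y)
    then obtain a Y where a: "a \<in> C" "x = v a" and Y: "Y \<subseteq> C" "y = (\<Sum>y\<in>Y. v y)"
      by (elim imageE exE conjE)
    have "finite Y" using Y assms(1) finite_subset by blast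
    show ?case
    proof (cases "a \<in> Y")
      case True
      then have "x + y = (\<Sum>y\<in>Y - {a}. v y)"
        using a Y \<open>finite Y\<close> by (simp add: sum.remove)
      then show ?thesis using Y by blast
    next
      case False
      then have "x + y = (\<Sum>y\<in>insert a Y. v y)"
        using a Y \<open>finite Y\<close> by simp
      then show ?thesis using Y a by blast
    qed
  qed
  then show thesis using that by blast
qed

lemma sum_in_vspan: "(\<And>y. y \<in> Y \<Longrightarrow> v y \<in> vspan X) \<Longrightarrow> (\<Sum>y\<in>Y. v y) \<in> vspan X"
  by (induction Y rule: infinite_finite_induct) (simp_all add: vspan_zero vspan_add)

lemma additive_vspan:
  assumes "additive f" "x \<in> vspan X" shows "f x \<in> vspan (f ` X)"
  using assms(2)
  by induction (simp_all add: additive.zero[OF assms(1)] additive.add[OF assms(1)]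
    vspan_zero vspan_step)

text \<open>A linear dependence over GF(2) is a non-empty subset with sum zero. The family is
  indexed, so equal vectors at different indices are dependent.\<close>

definition vindep :: "('a \<Rightarrow> vec) \<Rightarrow> 'a set \<Rightarrow> bool" where
  "vindep v X \<longleftrightarrow> (\<forall>Y\<subseteq>X. (\<Sum>x\<in>Y. v x) = 0 \<longrightarrow> Y = {})"

lemma vindep_insert:
  assumes "finite X" "vindep v X" "v a \<notin> vspan (v ` X)"
  shows "vindep v (insert a X)"
  unfolding vindep_def
proof (intro allI impI)
  fix Y assume Y: "Y \<subseteq> insert a X" "(\<Sum>x\<in>Y. v x) = 0"
  show "Y = {}"
  proof (cases "a \<in> Y")
    case True
    have "finite Y" using Y assms(1) finite_subset by blast
    then have "v a = (\<Sum>x\<in>Y - {a}. v x)" using True Y by (simp add: sum.remove)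
    also have "\<dots> \<in> vspan (v ` X)" using Y by (intro sum_in_vspan vspan_base) auto
    finally show ?thesis using assms by blast
  next
    case False
    then show ?thesis using Y assms unfolding vindep_def by blast
  qed
qed

text \<open>For \<open>\<psi>\<close> with \<open>\<psi> e = 1\<close> this is the quotient by \<open>e\<close>, realised as a projection
  of the space onto the kernel of \<open>\<psi>\<close>.\<close>

definition proj :: "(vec \<Rightarrow> bit) \<Rightarrow> vec \<Rightarrow> vec \<Rightarrow> vec" where
  "proj \<psi> e x = (if \<psi> x = 1 then x + e else x)"

lemma additive_proj:
  assumes "additive \<psi>" shows "additive (proj \<psi> e)"
proof
  fix x y
  show "proj \<psi> e (x + y) = proj \<psi> e x + proj \<psi> e y"
    unfolding proj_def using additive.add[OF assms, of x y]
    by (cases "\<psi> x"; cases "\<psi> y") (auto simp: add_ac)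
qed

lemma proj_eq_0_iff:
  assumes "additive \<psi>" "\<psi> e = 1" shows "proj \<psi> e x = 0 \<longleftrightarrow> x = 0 \<or> x = e"
  using assms additive.zero[OF assms(1)] by (auto simp: proj_def)

lemma additive_eq_iff:
  fixes f :: "vec \<Rightarrow> vec"
  assumes "additive f" shows "f x = f y \<longleftrightarrow> f (x + y) = 0"
  using additive.add[OF assms, of x y] by simp

lemma proj_eq_iff:
  assumes "additive \<psi>" "\<psi> e = 1" shows "proj \<psi> e x = proj \<psi> e y \<longleftrightarrow> x = y \<or> x = y + e"
proof -
  have "x + y = e \<longleftrightarrow> x = y + e" by (rule vec_add_eq_iff)
  then show ?thesis
    using additive_eq_iff[OF additive_proj[OF assms(1)]] proj_eq_0_iff[OF assms] by auto
qed

lemma additive_coeff: "additive (\<lambda>x::vec. coeff x i)"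
  by standard simp

lemma nonzero_functional:
  assumes "e \<noteq> (0::vec)" obtains \<psi> where "additive \<psi>" "\<psi> e = (1::bit)"
proof -
  from assms obtain i where "coeff e i \<noteq> 0" by (auto simp: poly_eq_iff)
  then show thesis using that[OF additive_coeff[of i]] by simp
qed

lemma additive_comp: "additive f \<Longrightarrow> additive g \<Longrightarrow> additive (f \<circ> g)"
  by (simp add: additive_def)

lemma additive_id: "additive id"
  by (simp add: additive_def)

text \<open>The linear maps that realise a contraction of elements of \<open>S\<close>.\<close>

definition contr :: "(vec \<Rightarrow> vec) \<Rightarrow> vec set \<Rightarrow> bool" where
  "contr f S \<longleftrightarrow> additive f \<and> (\<forall>x. f x = 0 \<longrightarrow> x \<in> vspan {s \<in> S. f s = 0})"

lemma contr_id: "contr id S"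
  by (simp add: contr_def additive_id vspan_zero)

lemma contr_proj:
  assumes "additive \<psi>" "\<psi> e = 1" "e \<in> S" shows "contr (proj \<psi> e) S"
  using assms proj_eq_0_iff[OF assms(1,2)] additive_proj
  by (auto simp: contr_def intro: vspan_zero vspan_base)

text \<open>If \<open>h (f x) = 0\<close>, then \<open>f x\<close> is a sum of vectors
  \<open>f s\<close> killed by \<open>h\<close>. Summing the corresponding \<open>s\<close> gives
  \<open>u\<close> with \<open>f u = f x\<close>, and \<open>u + x\<close> lies in the kernel of
  \<open>f\<close>.\<close>

lemma contr_comp:
  assumes f: "contr f S" and h: "contr h (f ` S)" shows "contr (h \<circ> f) S"
  unfolding contr_def
proof (intro conjI allI impI)
  have af: "additive f" and ah: "additive h" using f h by (auto simp: contr_def)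
  then show "additive (h \<circ> f)" by (simp add: additive_comp)
  let ?K = "{s \<in> S. (h \<circ> f) s = 0}"
  have lift: "\<exists>u\<in>vspan ?K. f u = y" if "y \<in> vspan {s \<in> f ` S. h s = 0}" for y
    using that
  proof induction
    case vspan_zero
    then show ?case using additive.zero[OF af] vspan.vspan_zero by blast
  next
    case (vspan_step x y)
    then obtain s u where "s \<in> S" "x = f s" "h x = 0" "u \<in> vspan ?K" "f u = y" by auto
    then have "s + u \<in> vspan ?K" "f (s + u) = x + y"
      by (auto intro: vspan.vspan_step simp: additive.add[OF af])
    then show ?case by blast
  qed
  fix x assume "(h \<circ> f) x = 0"
  then obtain u where u: "u \<in> vspan ?K" "f u = f x"
    using lift h by (auto simp: contr_def)
  then have "f (u + x) = 0" by (simp add: additive_eq_iff[OF af])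
  then have "u + x \<in> vspan {s \<in> S. f s = 0}" using f by (auto simp: contr_def)
  also have "\<dots> \<subseteq> vspan ?K"
    by (rule vspan_mono) (auto simp: additive.zero[OF ah])
  finally have "u + (u + x) \<in> vspan ?K" using u vspan_add by blast
  then show "x \<in> vspan ?K" by simp
qed

text \<open>The elements of \<open>C\<close> are projected away one after the other; those already
  sent to 0 are skipped.\<close>

lemma contr_kernel:
  assumes "finite C" "C \<subseteq> S"
  obtains h where "contr h S" "\<And>x. h x = 0 \<longleftrightarrow> x \<in> vspan C"
proof -
  have "\<exists>h. contr h S \<and> (\<forall>x. h x = 0 \<longleftrightarrow> x \<in> vspan C)"
    using assms
  proof (induction C rule: finite_induct)
    case empty
    show ?case
      using contr_id[of S] by (intro exI[of _ id]) (simp del: id_apply, simp)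
  next
    case (insert c C)
    then obtain h where h: "contr h S" "\<And>x. h x = 0 \<longleftrightarrow> x \<in> vspan C" by auto
    then have ah: "additive h" by (simp add: contr_def)
    show ?case
    proof (cases "h c = 0")
      case True
      then have "vspan (insert c C) = vspan C"
        using h by (intro equalityI vspan_mono vspan_least) (auto intro: vspan_base)
      then show ?thesis using h by auto
    next
      case False
      then obtain \<psi> where \<psi>: "additive \<psi>" "\<psi> (h c) = (1::bit)" by (rule nonzero_functional)
      have "x \<in> vspan (insert c C) \<longleftrightarrow> x \<in> vspan C \<or> x + c \<in> vspan C" for x
      proof
        have "c + (x + c) \<in> vspan (insert c C)" if "x + c \<in> vspan C"
          by (rule vspan_step) (use that vspan_mono[of C "insert c C"] in auto)
        moreover have "c + (x + c) = x" by (simp add: add_ac)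
        ultimately show "x \<in> vspan C \<or> x + c \<in> vspan C \<Longrightarrow> x \<in> vspan (insert c C)"
          using vspan_mono[of C "insert c C"] by auto
      qed (rule vspan_insert)
      then have "(proj \<psi> (h c) \<circ> h) x = 0 \<longleftrightarrow> x \<in> vspan (insert c C)" for x
        using h(2) additive_eq_iff[OF ah, of x c] by (simp add: proj_eq_0_iff[OF \<psi>])
      moreover have "contr (proj \<psi> (h c) \<circ> h) S"
        using insert by (intro contr_comp h contr_proj \<psi>) auto
      ultimately show ?thesis by blast
    qed
  qed
  then show thesis using that by blast
qed

section \<open>Dense Cayley graphs\<close>

text \<open>The Cayley graph on \<open>T\<close> with colours \<open>R\<close>. Edges are ordered
  pairs, so the number of edges divided by \<open>card T\<close> is the average degree.\<close>

definition edges :: "vec set \<Rightarrow> vec set \<Rightarrow> (vec \<times> vec) set" where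
  "edges R T = {(p, q). p \<in> T \<and> q \<in> T \<and> p \<noteq> q \<and> p + q \<in> R}"

lemma edges_mono: "R \<subseteq> R' \<Longrightarrow> T \<subseteq> T' \<Longrightarrow> edges R T \<subseteq> edges R' T'"
  unfolding edges_def by blast

lemma finite_edges: "finite T \<Longrightarrow> finite (edges R T)"
  by (rule finite_subset[of _ "T \<times> T"]) (auto simp: edges_def)

lemma card_edges_le: "finite T \<Longrightarrow> card (edges R T) \<le> card T * card T"
  using card_mono[of "T \<times> T" "edges R T"] by (auto simp: edges_def card_cartesian_product)

text \<open>If no two of \<open>p\<close>, \<open>q\<close>, \<open>0\<close> coincide, a random linear functional maps both
  \<open>p\<close> and \<open>q\<close> to \<open>1\<close> with probability \<open>1/4\<close>.\<close>

definition coordsum :: "nat set \<Rightarrow> vec \<Rightarrow> bit" where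
  "coordsum I x = (\<Sum>i\<in>I. coeff x i)"

lemma additive_coordsum: "additive (coordsum I)"
  by standard (simp only: coordsum_def coeff_add sum.distrib)

text \<open>Toggling the membership of \<open>j\<close> in \<open>I\<close> changes the value at
  \<open>x\<close>, which pairs the sets with value 1 with those with value 0.\<close>

lemma card_coordsum_1:
  assumes "finite J" "j \<in> J" "coeff x j = 1"
  shows "2 * card {I \<in> Pow J. coordsum I x = 1} = 2 ^ card J"
proof -
  let ?f = "\<lambda>I. if j \<in> I then I - {j} else insert j I"
  let ?A = "\<lambda>b. {I \<in> Pow J. coordsum I x = b}"
  have flip: "coordsum (?f I) x = coordsum I x + 1" if "I \<subseteq> J" for I
  proof -
    have "finite I" using that assms(1) finite_subset by blast
    then show ?thesis
      using assms(3) by (auto simp: coordsum_def sum.remove[of I j] add_ac)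
  qed
  have "bij_betw ?f (?A 1) (?A 0)"
    by (rule bij_betw_byWitness[where f' = ?f])
      (use assms flip in \<open>force simp: insert_absorb\<close>)+
  then have "card (?A 1) = card (?A 0)" by (rule bij_betw_same_card)
  moreover have "card (Pow J) = card (?A 1) + card (?A 0)"
    using assms(1) by (subst card_Un_disjoint[symmetric]) (auto intro!: arg_cong[of _ _ card])
  ultimately show ?thesis using assms(1) by (simp add: card_Pow)
qed

text \<open>The values at \<open>x\<close> and \<open>y\<close> differ exactly when the value at
  \<open>x + y\<close> is 1. Each of the three vectors has value 1 for half of the sets, and
  inclusion-exclusion leaves a quarter for the common event.\<close>

lemma card_coordsum_both:
  assumes "finite J" and x: "\<exists>j\<in>J. coeff x j = 1" and y: "\<exists>j\<in>J. coeff y j = 1"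
    and xy: "\<exists>j\<in>J. coeff (x + y) j = 1"
  shows "4 * card {I \<in> Pow J. coordsum I x = 1 \<and> coordsum I y = 1} = 2 ^ card J"
proof -
  let ?A = "\<lambda>z. {I \<in> Pow J. coordsum I z = 1}"
  let ?B = "{I \<in> Pow J. coordsum I x = 1 \<and> coordsum I y = 1}"
  have add: "coordsum I (x + y) = coordsum I x + coordsum I y" for I
    by (rule additive.add[OF additive_coordsum])
  have fin: "finite (?A z)" for z using assms(1) by simp
  have 1: "?A (x + y) \<union> ?B = ?A x \<union> ?A y"
  proof (intro set_eqI)
    fix I show "I \<in> ?A (x + y) \<union> ?B \<longleftrightarrow> I \<in> ?A x \<union> ?A y"
      by (cases "coordsum I x"; cases "coordsum I y") (auto simp: add)
  qed
  have 2: "?A (x + y) \<inter> ?B = {}" by (auto simp: add)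
  have 3: "?A x \<inter> ?A y = ?B" by auto
  have "finite ?B" using assms(1) by simp
  then have "card (?A (x + y)) + card ?B + card ?B = card (?A x) + card (?A y)"
    using card_Un_Int[OF fin fin, of x y] card_Un_disjoint[OF fin _ 2] unfolding 1 3 by simp
  moreover have "2 * card (?A x) = 2 ^ card J" "2 * card (?A y) = 2 ^ card J"
    "2 * card (?A (x + y)) = 2 ^ card J"
    using x y xy card_coordsum_1[OF assms(1)] by blast+
  ultimately show ?thesis by simp
qed

text \<open>An edge survives as soon as the functional is 1 at both ends, since its colour then has
  value 0. By averaging over all coordinate sums, some functional keeps a quarter of the
  edges.\<close>

lemma bipartition_by_functional:
  assumes "finite T" "0 \<notin> T"
  obtains \<phi> :: "vec \<Rightarrow> bit"
  where "additive \<phi>" "card (edges R T) \<le> 4 * card (edges {r \<in> R. \<phi> r = 0} {q \<in> T. \<phi> q = 1})"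
proof -
  let ?E = "edges R T"
  let ?X = "T \<union> (\<lambda>(p, q). p + q) ` ?E"
  have fE: "finite ?E" using assms by (simp add: finite_edges)
  \<comment> \<open>\<open>J\<close> must contain the degree of every vertex and every colour, so
    that each of these non-zero vectors has a coordinate 1 in \<open>J\<close>.\<close>
  define J where "J = {..Max (degree ` ?X)}"
  have nz: "\<exists>j\<in>J. coeff x j = 1" if "x \<in> ?X" for x
  proof
    have "x \<noteq> 0" using that assms(2) by (auto simp: edges_def)
    then show "coeff x (degree x) = 1" by (metis bit_not_one_iff leading_coeff_0_iff)
    show "degree x \<in> J" unfolding J_def using that assms(1) fE by simp
  qed
  have fJ: "finite J" by (simp add: J_def)
  let ?F = "\<lambda>I. edges {r \<in> R. coordsum I r = 0} {q \<in> T. coordsum I q = 1}"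
  have mem: "e \<in> ?F I \<longleftrightarrow> e \<in> ?E \<and> coordsum I (fst e) = 1 \<and> coordsum I (snd e) = 1" for e I
    by (auto simp: edges_def additive.add[OF additive_coordsum])
  have "4 * (\<Sum>I\<in>Pow J. card (?F I)) = 4 * (\<Sum>I\<in>Pow J. \<Sum>e\<in>?E. of_bool (e \<in> ?F I))"
  proof -
    have "card (?F I) = (\<Sum>e\<in>?E. of_bool (e \<in> ?F I))" for I
    proof -
      have "?E \<inter> {e. e \<in> ?F I} = ?F I" using mem by blast
      then show ?thesis using fE by simp
    qed
    then show ?thesis by simp
  qed
  also have "\<dots> = (\<Sum>e\<in>?E. 4 * (\<Sum>I\<in>Pow J. of_bool (e \<in> ?F I)))"
    by (subst sum.swap) (simp add: sum_distrib_left)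
  also have "\<dots> = (\<Sum>e\<in>?E. 2 ^ card J)"
  proof (rule sum.cong)
    fix e assume e: "e \<in> ?E"
    obtain p q where pq: "e = (p, q)" by fastforce
    have "p \<in> ?X" "q \<in> ?X" "p + q \<in> ?X" using e pq by (auto simp: edges_def)
    note nz[OF this(1)] nz[OF this(2)] nz[OF this(3)]
    from card_coordsum_both[OF fJ this]
    have "4 * card {I \<in> Pow J. coordsum I p = 1 \<and> coordsum I q = 1} = 2 ^ card J" .
    moreover have "Pow J \<inter> {I. e \<in> ?F I} = {I \<in> Pow J. coordsum I p = 1 \<and> coordsum I q = 1}"
      using e pq mem by auto
    ultimately show "4 * (\<Sum>I\<in>Pow J. of_bool (e \<in> ?F I)) = (2 ^ card J :: nat)"
      using fJ by simp
  qed simp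
  finally have total: "4 * (\<Sum>I\<in>Pow J. card (?F I)) = card ?E * 2 ^ card J" by simp
  have "\<exists>I\<in>Pow J. card ?E \<le> 4 * card (?F I)"
  proof (rule ccontr)
    assume "\<not> ?thesis"
    then have "(\<Sum>I\<in>Pow J. 4 * card (?F I)) < (\<Sum>I\<in>Pow J. card ?E)"
      using fJ by (intro sum_strict_mono) (auto simp: not_le)
    then show False
      using total fJ by (simp add: sum_distrib_left card_Pow mult.commute)
  qed
  then show thesis using that additive_coordsum by blast
qed

text \<open>The quotient by \<open>e\<close> identifies \<open>p\<close> with \<open>p + e\<close>. An edge is lost if it joins
  \<open>p\<close> to \<open>p + e\<close>, or if both its ends are identified with some other vertex, or if it belongs to a
  triangle that contains a pair \<open>q\<close>, \<open>q + e\<close>.\<close>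

lemma card_edges_proj:
  fixes T :: "vec set"
  assumes fin: "finite T" and \<psi>: "additive \<psi>" "\<psi> e = 1"
  defines "D \<equiv> {q \<in> T. q + e \<in> T}"
  shows "card (edges R T) \<le> card (edges (proj \<psi> e ` R) (proj \<psi> e ` T)) + card D
    + card {(p, q) \<in> edges R D. p + q \<noteq> e}
    + card {(p, q). p \<in> T \<and> q \<in> D \<and> (p, q) \<in> edges R T \<and> (p, q + e) \<in> edges R T}"
proof -
  let ?\<pi> = "proj \<psi> e"
  let ?f = "\<lambda>(p, q). (?\<pi> p, ?\<pi> q)"
  let ?E = "edges R T"
  let ?B0 = "{(p, q) \<in> ?E. p + q = e}"
  let ?B1 = "{(p, q) \<in> edges R D. p + q \<noteq> e}"
  let ?tri = "{(p, q). p \<in> T \<and> q \<in> D \<and> (p, q) \<in> ?E \<and> (p, q + e) \<in> ?E}"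
  \<comment> \<open>Of the two edges from \<open>p\<close> to a pair \<open>q\<close>,
    \<open>q + e\<close> only the one with \<open>\<psi> q = 1\<close> is discarded.
    \<open>?B2\<close> and \<open>?B3\<close> are its two orientations; they are charged to the
    members of \<open>?tri\<close> with \<open>\<psi> q = 1\<close> and \<open>\<psi> q = 0\<close>,
    so that together they cost \<open>card ?tri\<close> and not twice as much.\<close>
  let ?B2 = "{(p, q) \<in> ?E. p \<notin> D \<and> q \<in> D \<and> (p, q + e) \<in> ?E \<and> \<psi> q = 1}"
  let ?B3 = "{(q, p) \<in> ?E. p \<notin> D \<and> q \<in> D \<and> (p, q + e) \<in> ?E \<and> \<psi> q = 1}"
  have fE: "finite ?E" using fin by (rule finite_edges)
  have fD: "finite D" using fin by (simp add: D_def)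
  have sym: "(p, q) \<in> ?E \<longleftrightarrow> (q, p) \<in> ?E" for p q by (auto simp: edges_def add.commute)
  have \<psi>e: "\<psi> (x + e) = \<psi> x + 1" for x using additive.add[OF \<psi>(1), of x e] \<psi>(2) by simp
  let ?G = "?E - (?B0 \<union> ?B1 \<union> ?B2 \<union> ?B3)"
  have inj: "inj_on ?f ?G"
  proof (rule inj_onI)
    fix x y assume xG: "x \<in> ?G" and yG: "y \<in> ?G" and f: "?f x = ?f y"
    obtain p q p' q' where xy: "x = (p, q)" "y = (p', q')" by fastforce
    then have \<pi>: "?\<pi> p = ?\<pi> p'" "?\<pi> q = ?\<pi> q'" using f by simp_all
    have "(p, q) \<in> ?G" "(p', q') \<in> ?G" using xG yG unfolding xy by (simp_all only:)
    then have pq: "(p, q) \<in> ?E" "(p', q') \<in> ?E"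
      and n0: "p + q \<noteq> e" "p' + q' \<noteq> e"
      and n1: "(p, q) \<notin> ?B1" "(p', q') \<notin> ?B1"
      and n2: "(p, q) \<notin> ?B2" "(p', q') \<notin> ?B2" and n3: "(p, q) \<notin> ?B3" "(p', q') \<notin> ?B3"
      by blast+
    from \<pi> have alt: "p = p' \<or> p = p' + e" "q = q' \<or> q = q' + e"
      by (simp_all add: proj_eq_iff[OF \<psi>])
    have T: "p \<in> T" "p' \<in> T" "q \<in> T" "q' \<in> T" using pq by (auto simp: edges_def)
    \<comment> \<open>A surviving edge thus has an end outside \<open>D\<close>, which is determined
      by its projection. If the other ends were \<open>q\<close> and \<open>q + e\<close>, both
      edges of the triangle would survive, although \<psi> is 1 at one of these two ends.\<close>
    have nD: "\<not> (p \<in> D \<and> q \<in> D)"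
      using n0 n1 pq by (auto simp: edges_def)
    have bk: "p = p' + e \<longleftrightarrow> p' = p + e" "q = q' + e \<longleftrightarrow> q' = q + e"
      by (auto simp: add.assoc)
    have mem: "(x \<in> D) = (x + e \<in> D)" for x by (auto simp: D_def add.assoc)
    have "p = p' \<and> q = q'"
    proof (cases "p \<in> D")
      case True
      then have "q \<notin> D" using nD by blast
      then have q: "q' = q" using alt(2) T by (auto simp: D_def add.assoc)
      have "p = p'"
      proof (rule ccontr)
        assume "p \<noteq> p'"
        then have p: "p' = p + e" using alt bk by blast
        have "p' \<in> D" using True mem[of p] p by simp
        have e1: "p + e = p'" and e2: "p' + e = p" using p by (simp_all add: add.assoc)
        have E: "(q, p) \<in> ?E" "(q, p') \<in> ?E" using pq q sym by blast+
        have "\<psi> p = 1 \<or> \<psi> p' = 1" unfolding p \<psi>e by (cases "\<psi> p") auto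
        then have "(p, q) \<in> ?B3 \<or> (p', q') \<in> ?B3"
          using pq E True \<open>p' \<in> D\<close> \<open>q \<notin> D\<close> q by (simp add: e1 e2)
        then show False using n3 by blast
      qed
      then show ?thesis using q by simp
    next
      case False
      then have p: "p' = p" using alt(1) T by (auto simp: D_def add.assoc)
      have "q = q'"
      proof (rule ccontr)
        assume "q \<noteq> q'"
        then have q: "q' = q + e" using alt bk by blast
        have e1: "q + e = q'" and e2: "q' + e = q" using q by (simp_all add: add.assoc)
        have "q \<in> D" "q' \<in> D" using T by (simp_all add: D_def e1 e2)
        have "\<psi> q = 1 \<or> \<psi> q' = 1" unfolding q \<psi>e by (cases "\<psi> q") auto
        then have "(p, q) \<in> ?B2 \<or> (p', q') \<in> ?B2"
          using pq False \<open>q \<in> D\<close> \<open>q' \<in> D\<close> p by (simp add: e1 e2)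
        then show False using n2 by blast
      qed
      then show ?thesis using p by simp
    qed
    then show "x = y" using xy by simp
  qed
  have "?f ` ?G \<subseteq> edges (?\<pi> ` R) (?\<pi> ` T)"
  proof (rule image_subsetI)
    fix x assume x: "x \<in> ?G"
    obtain p q where xy: "x = (p, q)" by fastforce
    then have pq: "(p, q) \<in> ?E" "p + q \<noteq> e" "p \<noteq> q" using x by (auto simp: edges_def)
    then have "?\<pi> p \<noteq> ?\<pi> q" by (auto simp: proj_eq_iff[OF \<psi>] add_ac)
    then show "?f x \<in> edges (?\<pi> ` R) (?\<pi> ` T)"
      using pq xy additive.add[OF additive_proj[OF \<psi>(1)], symmetric] by (auto simp: edges_def)
  qed
  then have G: "card ?G \<le> card (edges (?\<pi> ` R) (?\<pi> ` T))"
    by (rule card_inj_on_le[OF inj]) (simp add: finite_edges fin)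
  have "?B0 \<subseteq> (\<lambda>q. (q, q + e)) ` D"
  proof
    fix x assume x: "x \<in> ?B0"
    obtain p q where pq: "x = (p, q)" by fastforce
    then have "p \<in> T" "q \<in> T" "p + q = e" using x by (auto simp: edges_def)
    moreover from this(3) have "p + e = q" by auto
    ultimately show "x \<in> (\<lambda>q. (q, q + e)) ` D" unfolding pq D_def by force
  qed
  then have B0: "card ?B0 \<le> card D"
    using surj_card_le[OF fD] by blast
  let ?t = "\<lambda>b. {(p, q) \<in> ?tri. \<psi> q = b}"
  have ftri: "finite ?tri" by (rule finite_subset[OF _ fE]) auto
  have "?B2 \<subseteq> ?t 1" by (auto simp: edges_def)
  moreover have ft: "finite (?t b)" for b by (rule finite_subset[OF _ ftri]) auto
  ultimately have B2: "card ?B2 \<le> card (?t 1)" by (simp add: card_mono)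
  have "?B3 \<subseteq> (\<lambda>(p, q). (q + e, p)) ` ?t 0"
  proof
    fix x assume x: "x \<in> ?B3"
    obtain q p where qp: "x = (q, p)" by fastforce
    have *: "(q, p) \<in> ?E" "p \<notin> D" "q \<in> D" "(p, q + e) \<in> ?E" "\<psi> q = 1"
      using x qp by simp_all
    have "q + e \<in> D" using * by (auto simp: D_def add.assoc)
    moreover have "q + e + e = q" by (simp add: add.assoc)
    moreover have "p \<in> T" using * by (auto simp: edges_def)
    ultimately have "(p, q + e) \<in> ?t 0" using * sym[of q p] by (auto simp: \<psi>e)
    then show "x \<in> (\<lambda>(p, q). (q + e, p)) ` ?t 0"
      by (rule rev_image_eqI) (simp add: qp add.assoc)
  qed
  then have B3: "card ?B3 \<le> card (?t 0)" using surj_card_le[OF ft] by blast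
  have "card ?tri = card (?t 1 \<union> ?t 0)" by (rule arg_cong[of _ _ card]) auto
  also have "\<dots> = card (?t 1) + card (?t 0)" using ft by (intro card_Un_disjoint) auto
  finally have t: "card ?tri = card (?t 1) + card (?t 0)" .
  have "card ?E = card (?G \<union> (?B0 \<union> ?B1 \<union> ?B2 \<union> ?B3))"
    by (rule arg_cong[of _ _ card]) (auto simp: edges_def D_def)
  also have "\<dots> \<le> card ?G + (card ?B0 + card ?B1 + card ?B2 + card ?B3)"
    by (meson add_mono card_Un_le order_refl order_trans)
  finally show ?thesis using G B0 B2 B3 t by linarith
qed

lemma card_proj_pairs:
  fixes T :: "vec set"
  assumes fin: "finite T" and \<psi>: "additive \<psi>" "\<psi> e = 1"
  shows "2 * card (proj \<psi> e ` T) + card {q \<in> T. q + e \<in> T} \<le> 2 * card T"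
proof -
  let ?D = "{q \<in> T. q + e \<in> T}"
  let ?D1 = "{q \<in> ?D. \<psi> q = 1}"
  have \<psi>e: "\<psi> (x + e) = \<psi> x + 1" for x using additive.add[OF \<psi>(1), of x e] \<psi>(2) by simp
  have "?D \<subseteq> ?D1 \<union> (\<lambda>q. q + e) ` ?D1"
  proof
    fix q assume q: "q \<in> ?D"
    show "q \<in> ?D1 \<union> (\<lambda>q. q + e) ` ?D1"
    proof (cases "\<psi> q = 1")
      case False
      then have "q + e \<in> ?D1" "q = (q + e) + e" using q by (auto simp: add.assoc \<psi>e)
      then show ?thesis by blast
    qed (use q in auto)
  qed
  then have "card ?D \<le> card (?D1 \<union> (\<lambda>q. q + e) ` ?D1)"
    using fin by (intro card_mono) auto
  also have "\<dots> \<le> card ?D1 + card ?D1"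
    using fin card_Un_le[of ?D1 "(\<lambda>q. q + e) ` ?D1"] card_image_le[of ?D1 "\<lambda>q. q + e"] by simp
  finally have D: "card ?D \<le> 2 * card ?D1" by simp
  have "proj \<psi> e ` T \<subseteq> proj \<psi> e ` (T - ?D1)"
  proof
    fix x assume "x \<in> proj \<psi> e ` T"
    then obtain q where q: "q \<in> T" "x = proj \<psi> e q" by blast
    show "x \<in> proj \<psi> e ` (T - ?D1)"
    proof (cases "q \<in> ?D1")
      case True
      then have "q + e \<in> T - ?D1" "x = proj \<psi> e (q + e)"
        using q by (auto simp: \<psi>e proj_eq_iff[OF \<psi>] add.assoc)
      then show ?thesis by blast
    qed (use q in auto)
  qed
  then have "card (proj \<psi> e ` T) \<le> card (T - ?D1)"
    using fin by (meson card_mono card_image_le finite_Diff finite_imageI order_trans)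
  also have "\<dots> = card T - card ?D1" using fin by (intro card_Diff_subset) auto
  finally show ?thesis using D card_mono[OF fin, of ?D1] by simp
qed

text \<open>Both cases are cast in one form, a vector \<open>e\<close> and a set \<open>X\<close>
  that is dense modulo \<open>e\<close>: either a colour \<open>e\<close> with the pairs
  \<open>D e\<close>, or a vertex \<open>z\<close> with its neighbourhood \<open>N z\<close>. In
  either case \<open>X\<close> translated by \<open>e\<close> consists of vertices or colours, as
  needed to extend a fan.\<close>

lemma dense_link:
  fixes c :: real and T :: "vec set"
  assumes fin: "finite T" and T: "T \<noteq> {}" and \<phi>: "additive \<phi>"
    and \<phi>R: "\<And>r. r \<in> R \<Longrightarrow> \<phi> r = (0::bit)" and \<phi>T: "\<And>q. q \<in> T \<Longrightarrow> \<phi> q = 1"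
    and c: "c > 2" and dense: "c * card T \<le> card (edges R T)"
    and stuck: "\<And>e \<psi> p. \<lbrakk>e \<in> R; e \<noteq> 0; additive \<psi>; \<psi> e = (1::bit); p \<in> T; p + e \<in> T\<rbrakk>
      \<Longrightarrow> card (edges (proj \<psi> e ` R) (proj \<psi> e ` T)) < c * card (proj \<psi> e ` T)"
  obtains e X where "e \<noteq> 0" "X \<subseteq> T" "X \<noteq> {}" "e \<notin> X" "\<And>q. q \<in> X \<Longrightarrow> q + e \<in> R \<union> T"
    "\<And>\<psi>. \<lbrakk>additive \<psi>; \<psi> e = 1\<rbrakk> \<Longrightarrow> (c / 8 - 1 / 4) * card (proj \<psi> e ` X)
      \<le> card (edges (proj \<psi> e ` R) (proj \<psi> e ` X))"
proof -
  let ?E = "edges R T"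
  define col where "col = (\<lambda>(p, q). p + q) ` ?E"
  define D where "D e = {q \<in> T. q + e \<in> T}" for e
  define B1 where "B1 e = {(p, q) \<in> edges R (D e). p + q \<noteq> e}" for e
  define tri where "tri e = {(p, q). p \<in> T \<and> q \<in> D e \<and> (p, q) \<in> ?E \<and> (p, q + e) \<in> ?E}" for e
  define N where "N z = {q. (z, q) \<in> ?E}" for z
  have fE: "finite ?E" using fin by (rule finite_edges)
  then have fcol: "finite col" by (simp add: col_def)
  have fD: "finite (D e)" for e using fin by (simp add: D_def)
  have fN: "finite (N z)" for z by (rule finite_subset[OF _ fin]) (auto simp: N_def edges_def)
  have ftri: "finite (tri e)" for e by (rule finite_subset[OF _ fE]) (auto simp: tri_def)
  have colI: "e \<in> R \<and> e \<noteq> 0 \<and> (\<exists>p\<in>T. p + e \<in> T)" if "e \<in> col" for e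
    using that by (force simp: col_def edges_def)
  \<comment> \<open>Identifying the pairs saves at least half of \<open>card (D e)\<close> vertices,
    so keeping average degree \<open>c\<close> would permit a loss of
    \<open>c / 2 * card (D e)\<close> edges; at most \<open>card (D e)\<close> lost edges join
    \<open>q\<close> to \<open>q + e\<close>.\<close>
  have loss: "(c / 2 - 1) * card (D e) < card (B1 e) + card (tri e)" if e: "e \<in> col" for e
  proof -
    obtain p where p: "e \<in> R" "e \<noteq> 0" "p \<in> T" "p + e \<in> T" using colI[OF e] by blast
    obtain \<psi> where \<psi>: "additive \<psi>" "\<psi> e = (1::bit)" using nonzero_functional[OF p(2)] .
    have "c * card T < c * card (proj \<psi> e ` T) + card (D e) + card (B1 e) + card (tri e)"
      using dense stuck[OF p(1,2) \<psi> p(3,4)] card_edges_proj[OF fin \<psi>, of R]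
      unfolding D_def B1_def tri_def by linarith
    moreover have "c * (2 * card (proj \<psi> e ` T) + card (D e)) \<le> c * (2 * card T)"
      using c card_proj_pairs[OF fin \<psi>] unfolding D_def by (intro mult_left_mono) linarith+
    ultimately show ?thesis by (simp add: algebra_simps)
  qed
  show thesis
  \<comment> \<open>At least half of the loss comes from edges between pairs for some colour, or
    more than half comes from triangles for every colour.\<close>
  proof (cases "\<exists>e\<in>col. (c / 4 - 1 / 2) * card (D e) \<le> card (B1 e)")
    case True
    then obtain e where e: "e \<in> col" "(c / 4 - 1 / 2) * card (D e) \<le> card (B1 e)" by blast
    show thesis
    proof (rule that[of e "D e"])
      show "e \<noteq> 0" "D e \<noteq> {}" using colI[OF e(1)] by (auto simp: D_def)
      show "e \<notin> D e" using colI[OF e(1)] \<phi>R \<phi>T by (force simp: D_def)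
      fix \<psi> assume \<psi>: "additive \<psi>" "\<psi> e = (1::bit)"
      let ?\<pi> = "proj \<psi> e"
      let ?E' = "edges (?\<pi> ` R) (?\<pi> ` D e)"
      \<comment> \<open>Each end of an edge of the quotient has at most two preimages, so at most
        four edges are identified. As the number of vertices is at least halved, the average degree
        drops by at most a factor of 2.\<close>
      have "B1 e \<subseteq> (\<lambda>((a, b), u, v). (a + u, b + v)) ` (?E' \<times> {0, e} \<times> {0, e})"
      proof
        fix x assume x: "x \<in> B1 e"
        obtain p q where pq: "x = (p, q)" by fastforce
        then have "(p, q) \<in> edges R (D e)" "p + q \<noteq> e" using x by (auto simp: B1_def)
        moreover from this have "?\<pi> p \<noteq> ?\<pi> q" by (auto simp: proj_eq_iff[OF \<psi>] edges_def add_ac)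
        ultimately have "(?\<pi> p, ?\<pi> q) \<in> ?E'"
          using additive.add[OF additive_proj[OF \<psi>(1)], symmetric] by (auto simp: edges_def)
        moreover have "p + ?\<pi> p \<in> {0, e}" for p by (simp add: proj_def)
        ultimately have "((?\<pi> p, ?\<pi> q), p + ?\<pi> p, q + ?\<pi> q) \<in> ?E' \<times> {0, e} \<times> {0, e}" by blast
        then show "x \<in> (\<lambda>((a, b), u, v). (a + u, b + v)) ` (?E' \<times> {0, e} \<times> {0, e})"
          unfolding pq by (rule rev_image_eqI) (simp add: vec_add_cancel)
      qed
      moreover have fE': "finite ?E'" using fD by (simp add: finite_edges)
      ultimately have "card (B1 e) \<le> card (?E' \<times> {0, e} \<times> {0, e})"
        by (intro surj_card_le) auto
      also have "\<dots> = 4 * card ?E'"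
        using colI[OF e(1)] by (auto simp: card_cartesian_product)
      finally have "card (B1 e) \<le> 4 * card ?E'" .
      then have E': "(c / 4 - 1 / 2) * card (D e) \<le> 4 * real (card ?E')"
        using e(2) by linarith
      have "{q \<in> D e. q + e \<in> D e} = D e" by (auto simp: D_def add.assoc)
      then have "2 * card (?\<pi> ` D e) \<le> card (D e)"
        using card_proj_pairs[OF fD \<psi>, of e] by simp
      then have "(c / 4 - 1 / 2) * (2 * card (?\<pi> ` D e)) \<le> (c / 4 - 1 / 2) * card (D e)"
        using c by (intro mult_left_mono) linarith+
      with E' show "(c / 8 - 1 / 4) * card (?\<pi> ` D e) \<le> card ?E'"
        by (simp add: algebra_simps)
    qed (auto simp: D_def)
  next
    case False
    have E: "card ?E = (\<Sum>z\<in>T. card (N z))"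
    proof -
      have "?E = Sigma T N" by (auto simp: N_def edges_def)
      then show ?thesis using fin fN by simp
    qed
    have "0 < c * card T" using c T fin by (simp add: card_gt_0_iff)
    then have "?E \<noteq> {}" using dense by (intro notI) simp
    then have col: "col \<noteq> {}" by (simp add: col_def)
    \<comment> \<open>An edge \<open>(p, q)\<close> is recovered from its colour and its first end,
      which lies in a pair of that colour. Hence the bounds for the single colours add up to a
      multiple of \<open>card ?E\<close>.\<close>
    have "?E \<subseteq> (\<lambda>(e, q). (q, q + e)) ` Sigma col D"
    proof
      fix x assume x: "x \<in> ?E"
      obtain p q where pq: "x = (p, q)" by fastforce
      then have "p + q \<in> col" "p \<in> D (p + q)" using x by (force simp: col_def D_def edges_def)+
      then show "x \<in> (\<lambda>(e, q). (q, q + e)) ` Sigma col D" unfolding pq by force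
    qed
    then have "card ?E \<le> card (Sigma col D)"
      using fcol fD by (intro surj_card_le) auto
    then have "card ?E \<le> (\<Sum>e\<in>col. card (D e))" using fcol fD by simp
    then have "(c / 4 - 1 / 2) * card ?E \<le> (c / 4 - 1 / 2) * (\<Sum>e\<in>col. card (D e))"
      using c by (intro mult_left_mono of_nat_mono) auto
    also have "\<dots> = (\<Sum>e\<in>col. (c / 4 - 1 / 2) * card (D e))" by (simp add: sum_distrib_left)
    also have "\<dots> < (\<Sum>e\<in>col. real (card (tri e)))"
    proof (rule sum_strict_mono[OF fcol col])
      fix e assume "e \<in> col"
      then show "(c / 4 - 1 / 2) * card (D e) < card (tri e)"
        using False loss[of e] by (force simp: algebra_simps)
    qed
    also have "\<dots> = card (Sigma col tri)" using fcol ftri by simp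
    \<comment> \<open>A triangle \<open>p\<close>, \<open>q\<close>, \<open>q + e\<close> is an edge
      inside the neighbourhood of \<open>p\<close>. As the neighbourhoods have total size
      \<open>card ?E\<close>, averaging over \<open>p\<close> yields a dense one.\<close>
    also have "\<dots> \<le> card (SIGMA z:T. edges R (N z))"
    proof (rule of_nat_mono, rule card_inj_on_le)
      let ?g = "\<lambda>(e, p, q). (p, q, q + e)"
      show "inj_on ?g (Sigma col tri)" by (auto simp: inj_on_def)
      show "?g ` Sigma col tri \<subseteq> (SIGMA z:T. edges R (N z))"
        using colI by (auto simp: tri_def N_def edges_def)
      show "finite (SIGMA z:T. edges R (N z))" using fin fN finite_edges by blast
    qed
    also have "\<dots> = (\<Sum>z\<in>T. real (card (edges R (N z))))"
      using fin fN finite_edges by simp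
    finally have lt: "(\<Sum>z\<in>T. (c / 4 - 1 / 2) * card (N z)) < (\<Sum>z\<in>T. real (card (edges R (N z))))"
      unfolding E by (simp add: sum_distrib_left)
    have "\<exists>z\<in>T. (c / 4 - 1 / 2) * card (N z) < card (edges R (N z))"
    proof (rule ccontr)
      assume "\<not> ?thesis"
      then have "(\<Sum>z\<in>T. real (card (edges R (N z)))) \<le> (\<Sum>z\<in>T. (c / 4 - 1 / 2) * card (N z))"
        by (intro sum_mono) auto
      then show False using lt by simp
    qed
    then obtain z where z: "z \<in> T" "(c / 4 - 1 / 2) * card (N z) < card (edges R (N z))" by blast
    have NT: "N z \<subseteq> T" by (auto simp: N_def edges_def)
    show thesis
    proof (rule that[of z "N z"])
      show "z \<noteq> 0" using \<phi>T[OF z(1)] additive.zero[OF \<phi>] by auto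
      show "N z \<noteq> {}" using z(2) by (auto simp: edges_def)
      fix \<psi> assume \<psi>: "additive \<psi>" "\<psi> z = (1::bit)"
      let ?\<pi> = "proj \<psi> z"
      have \<phi>N: "\<phi> q = 1" if "q \<in> N z" for q using that NT \<phi>T by blast
      \<comment> \<open>All of \<open>T\<close> has \<phi> equal to 1, so \<open>q + z\<close> has
        value 0 and \<open>N z\<close> contains no pair \<open>q\<close>,
        \<open>q + z\<close>.\<close>
      have inj: "inj_on ?\<pi> (N z)"
      proof (rule inj_onI)
        fix p q assume "p \<in> N z" "q \<in> N z" "?\<pi> p = ?\<pi> q"
        moreover have "\<phi> (q + z) = 0" if "q \<in> N z" for q
          using additive.add[OF \<phi>, of q z] \<phi>N[OF that] \<phi>T[OF z(1)] by simp
        ultimately show "p = q" using \<phi>N by (force simp: proj_eq_iff[OF \<psi>])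
      qed
      have "card (edges R (N z)) \<le> card (edges (?\<pi> ` R) (?\<pi> ` N z))"
      proof (rule card_inj_on_le)
        let ?g = "\<lambda>(p, q). (?\<pi> p, ?\<pi> q)"
        show "inj_on ?g (edges R (N z))"
          using inj by (auto simp: inj_on_def edges_def)
        show "?g ` edges R (N z) \<subseteq> edges (?\<pi> ` R) (?\<pi> ` N z)"
          using inj additive.add[OF additive_proj[OF \<psi>(1)], symmetric]
          by (auto simp: edges_def inj_on_eq_iff)
        show "finite (edges (?\<pi> ` R) (?\<pi> ` N z))" using fN by (simp add: finite_edges)
      qed
      \<comment> \<open>The neighbourhood retains its density in the quotient; the bound is halved
        to match the other case.\<close>
      moreover have "(c / 8 - 1 / 4) * card (?\<pi> ` N z) \<le> (c / 4 - 1 / 2) * card (N z)"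
        using c card_image_le[OF fN, of ?\<pi> z] by (intro mult_mono) auto
      ultimately show "(c / 8 - 1 / 4) * card (?\<pi> ` N z) \<le> card (edges (?\<pi> ` R) (?\<pi> ` N z))"
        using z(2) by linarith
    qed (use NT in \<open>auto simp: N_def edges_def add.commute\<close>)
  qed
qed

section \<open>Fans\<close>

text \<open>In the graphic case \<open>S\<close> consists of the edges of a graph, the kernel of \<open>g\<close> is spanned by
  the differences of \<open>k + 1\<close> vertices that are identified by \<open>g\<close>, and each element of \<open>T\<close>
  stands for a common neighbour of these vertices.\<close>

definition fan :: "nat \<Rightarrow> vec set \<Rightarrow> (vec \<Rightarrow> vec) \<Rightarrow> vec set \<Rightarrow> bool" where
  "fan k S g T \<longleftrightarrow> finite S \<and> additive g \<and> finite {x. g x = 0} \<and> card {x. g x = 0} \<le> 2 ^ k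
    \<and> finite T \<and> 0 \<notin> T \<and> (\<forall>q\<in>T. \<exists>l D. l \<in> S \<and> g l = q \<and> D \<subseteq> {x. g x = 0} \<and> card D = k
      \<and> vindep (\<lambda>x. x) D \<and> (\<forall>d\<in>D. l + d \<in> S))"

lemma fan_subset: "fan k S g T \<Longrightarrow> T' \<subseteq> T \<Longrightarrow> fan k S g T'"
  unfolding fan_def by (auto dest: finite_subset)

lemma fan_image:
  assumes "fan k S g T" shows "T \<subseteq> g ` S"
proof
  fix q assume "q \<in> T"
  then obtain l where "l \<in> S" "g l = q" using assms unfolding fan_def by meson
  then show "q \<in> g ` S" by blast
qed

lemma fan_0:
  assumes "finite S" "T \<subseteq> S" "0 \<notin> T" shows "fan 0 S id T"
  using assms finite_subset[OF assms(2,1)]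
  by (auto simp: fan_def additive_id vindep_def intro!: exI[of _ "{}"])

text \<open>The contraction of \<open>s\<close> is defined through \<open>\<psi> \<circ> g\<close>,
  which vanishes on the kernel of \<open>g\<close>. It therefore commutes with translations by that
  kernel, and the same \<open>D\<close> still serves every vertex.\<close>

lemma fan_contract:
  assumes fan: "fan k S g T" and \<psi>: "additive \<psi>" "\<psi> (g s) = 1" and nT: "g s \<notin> T"
  shows "fan k (proj (\<psi> \<circ> g) s ` S) g (proj \<psi> (g s) ` T)"
    and "g ` proj (\<psi> \<circ> g) s ` S = proj \<psi> (g s) ` g ` S"
proof -
  let ?f = "proj (\<psi> \<circ> g) s"
  have g: "additive g" and fin: "finite S" "finite {x. g x = 0}" "finite T"
    and K: "card {x. g x = 0} \<le> 2 ^ k" using fan unfolding fan_def by blast+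
  have gf: "g (?f x) = proj \<psi> (g s) (g x)" for x
    by (simp add: proj_def additive.add[OF g])
  then show "g ` ?f ` S = proj \<psi> (g s) ` g ` S" by (simp add: image_image)
  have "\<psi> 0 = 0" by (rule additive.zero[OF \<psi>(1)])
  then have fd: "?f (x + d) = ?f x + d" if "g d = 0" for x d
    using that by (simp add: proj_def additive.add[OF g] add_ac)
  show "fan k (?f ` S) g (proj \<psi> (g s) ` T)"
    unfolding fan_def
  proof (intro conjI ballI)
    show "0 \<notin> proj \<psi> (g s) ` T"
      using nT fan proj_eq_0_iff[OF \<psi>] by (force simp: fan_def)
    fix q' assume "q' \<in> proj \<psi> (g s) ` T"
    then obtain q where q: "q \<in> T" "q' = proj \<psi> (g s) q" by blast
    then obtain l D where lD: "l \<in> S" "g l = q" "D \<subseteq> {x. g x = 0}" "card D = k"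
      "vindep (\<lambda>x. x) D" "\<forall>d\<in>D. l + d \<in> S"
      using fan unfolding fan_def by meson
    have "\<forall>d\<in>D. ?f l + d \<in> ?f ` S"
    proof
      fix d assume "d \<in> D"
      then have "?f l + d = ?f (l + d)" using lD(3) by (intro fd[symmetric]) blast
      then show "?f l + d \<in> ?f ` S" using lD(6) \<open>d \<in> D\<close> by simp
    qed
    then show "\<exists>l D. l \<in> ?f ` S \<and> g l = q' \<and> D \<subseteq> {x. g x = 0} \<and> card D = k
      \<and> vindep (\<lambda>x. x) D \<and> (\<forall>d\<in>D. l + d \<in> ?f ` S)"
      using lD q gf by blast
  qed (use g fin K in simp_all)
qed

text \<open>For preimages \<open>l\<close> of \<open>q\<close> and \<open>l'\<close> of
  \<open>q + e\<close>, the difference \<open>l + l'\<close> is mapped by \<open>g\<close> to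
  \<open>e\<close>, which is not 0, so it is independent of \<open>D\<close> and becomes the new
  member. The kernel gains at most one coset.\<close>

lemma fan_extend:
  assumes fan: "fan k S g T" and \<psi>: "additive \<psi>" "\<psi> e = 1" and e: "e \<noteq> 0"
    and X: "X \<subseteq> T" "e \<notin> X" "\<And>q. q \<in> X \<Longrightarrow> q + e \<in> g ` S"
  shows "fan (Suc k) S (proj \<psi> e \<circ> g) (proj \<psi> e ` X)"
proof -
  let ?g = "proj \<psi> e \<circ> g"
  let ?K = "{x. g x = 0}"
  have g: "additive g" and K: "finite ?K" "card ?K \<le> 2 ^ k" "finite T" "finite S"
    using fan by (auto simp: fan_def)
  have kernel: "?g x = 0 \<longleftrightarrow> g x = 0 \<or> g x = e" for x
    by (simp add: proj_eq_0_iff[OF \<psi>])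
  have "\<exists>a. {x. ?g x = 0} \<subseteq> ?K \<union> (\<lambda>x. x + a) ` ?K"
  proof (cases "\<exists>a. g a = e")
    case True
    then obtain a where a: "g a = e" by blast
    have "x \<in> ?K \<union> (\<lambda>x. x + a) ` ?K" if "?g x = 0" for x
    proof (cases "g x = 0")
      case False
      then have "g (x + a) = 0" using that kernel a additive.add[OF g] by simp
      then show ?thesis by (intro UnI2 rev_image_eqI[of "x + a"]) (simp_all add: add.assoc)
    qed simp
    then show ?thesis by blast
  next
    case False
    then show ?thesis using kernel by blast
  qed
  then obtain a where a: "{x. ?g x = 0} \<subseteq> ?K \<union> (\<lambda>x. x + a) ` ?K" by blast
  have fin: "finite (?K \<union> (\<lambda>x. x + a) ` ?K)" using K by simp
  have "card {x. ?g x = 0} \<le> card ?K + card ((\<lambda>x. x + a) ` ?K)"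
    using card_mono[OF fin a] card_Un_le order_trans by blast
  also have "\<dots> \<le> 2 ^ Suc k" using K card_image_le[OF K(1), of "\<lambda>x. x + a"] by simp
  finally have card: "card {x. ?g x = 0} \<le> 2 ^ Suc k" .
  show ?thesis
    unfolding fan_def
  proof (intro conjI ballI)
    show "additive ?g" by (intro additive_comp additive_proj \<psi> g)
    show "finite {x. ?g x = 0}" using a fin finite_subset by blast
    show "finite (proj \<psi> e ` X)" using K X finite_subset by blast
    show "0 \<notin> proj \<psi> e ` X"
    proof
      assume "0 \<in> proj \<psi> e ` X"
      then obtain q where "q \<in> X" "proj \<psi> e q = 0" by auto
      then show False using X fan proj_eq_0_iff[OF \<psi>] by (auto simp: fan_def)
    qed
    fix q' assume "q' \<in> proj \<psi> e ` X"
    then obtain q where q: "q \<in> X" "q' = proj \<psi> e q" by blast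
    with X(1) have "q \<in> T" by blast
    then obtain l D where lD: "l \<in> S" "g l = q" "D \<subseteq> ?K" "card D = k"
      "vindep (\<lambda>x. x) D" "\<forall>d\<in>D. l + d \<in> S"
      using fan unfolding fan_def by meson
    from X(3)[OF q(1)] obtain l' where l': "l' \<in> S" "g l' = q + e" by auto
    have ga: "g (l + l') = e" using lD l' by (simp add: additive.add[OF g])
    have nK: "l + l' \<notin> vspan ((\<lambda>x. x) ` D)"
    proof
      assume "l + l' \<in> vspan ((\<lambda>x. x) ` D)"
      then have "g (l + l') \<in> vspan (g ` D)" using additive_vspan[OF g] by simp
      also have "\<dots> \<subseteq> vspan {0}" using lD by (intro vspan_mono) auto
      also have "\<dots> \<subseteq> vspan {}" by (rule vspan_least) simp
      finally show False using ga e by simp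
    qed
    have "finite D" using lD K finite_subset by blast
    then have "vindep (\<lambda>x. x) (insert (l + l') D)" using lD nK by (intro vindep_insert)
    moreover have "card (insert (l + l') D) = Suc k"
      using \<open>finite D\<close> nK vspan_base[of _ D] lD by (subst card_insert_disjoint) auto
    moreover have "insert (l + l') D \<subseteq> {x. ?g x = 0}" using lD(3) ga kernel by auto
    moreover have "\<forall>d\<in>insert (l + l') D. l + d \<in> S" using lD l' by simp
    moreover have "?g l = q'" using lD q by simp
    ultimately show "\<exists>l D. l \<in> S \<and> ?g l = q' \<and> D \<subseteq> {x. ?g x = 0} \<and> card D = Suc k
      \<and> vindep (\<lambda>x. x) D \<and> (\<forall>d\<in>D. l + d \<in> S)"
      using lD(1) by blast
  qed (use K card in auto)
qed

text \<open>Contracting a colour that joins two vertices of \<open>T\<close> identifies them, so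
  contracting while the average degree stays at least \<open>c\<close> terminates, by induction on
  \<open>card T\<close>. When this is stuck, \<open>dense_link\<close> gives the direction in which
  \<open>fan_extend\<close> applies.\<close>

lemma fan_step_separated:
  fixes c :: real
  assumes "fan k S g T" "T \<noteq> {}" "additive \<phi>" "\<And>q. q \<in> T \<Longrightarrow> \<phi> q = (1::bit)" "c > 2"
    and "c * card T \<le> card (edges {r \<in> g ` S. \<phi> r = 0} T)"
  shows "\<exists>f g' T'. contr f S \<and> fan (Suc k) (f ` S) g' T' \<and> T' \<noteq> {}
    \<and> (c / 8 - 1 / 4) * card T' \<le> card (edges (g' ` f ` S) T')"
  using assms
proof (induction "card T" arbitrary: S T rule: less_induct)
  case less
  let ?R = "{r \<in> g ` S. \<phi> r = 0}"
  have fan: "fan k S g T" and \<phi>: "additive \<phi>" by fact+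
  have finT: "finite T" using fan by (simp add: fan_def)
  show ?case
  proof (cases "\<exists>e \<psi> p. e \<in> ?R \<and> e \<noteq> 0 \<and> additive \<psi> \<and> \<psi> e = (1::bit) \<and> p \<in> T \<and> p + e \<in> T
      \<and> c * card (proj \<psi> e ` T) \<le> card (edges (proj \<psi> e ` ?R) (proj \<psi> e ` T))")
    case True
    then obtain s \<psi> p where s: "s \<in> S" "\<phi> (g s) = 0" and \<psi>: "additive \<psi>" "\<psi> (g s) = (1::bit)"
      and p: "p \<in> T" "p + g s \<in> T"
      and dense: "c * card (proj \<psi> (g s) ` T)
        \<le> card (edges (proj \<psi> (g s) ` ?R) (proj \<psi> (g s) ` T))"
      by auto
    let ?e = "g s"
    let ?f = "proj (\<psi> \<circ> g) s"
    let ?T = "proj \<psi> ?e ` T"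
    have nT: "?e \<notin> T" using less.prems(4) s(2) by force
    note contr = fan_contract[OF fan \<psi> nT]
    \<comment> \<open>The contracted colour lies in the kernel of \<phi>, so \<phi> still separates
      vertices from colours afterwards.\<close>
    have \<phi>p: "\<phi> (proj \<psi> ?e x) = \<phi> x" for x
      using s(2) additive.add[OF \<phi>] by (simp add: proj_def)
    have R: "{r \<in> g ` ?f ` S. \<phi> r = 0} = proj \<psi> ?e ` ?R"
      unfolding contr(2) using \<phi>p by auto
    have "p \<in> {q \<in> T. q + ?e \<in> T}" using p by simp
    then have "card {q \<in> T. q + ?e \<in> T} > 0" using finT by (simp add: card_gt_0_iff) blast
    then have "card ?T < card T" using card_proj_pairs[OF finT \<psi>] by linarith
    moreover have "?T \<noteq> {}" using p by blast
    moreover have "\<phi> q = 1" if "q \<in> ?T" for q using that \<phi>p less.prems(4) by auto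
    ultimately have "\<exists>f g' T'. contr f (?f ` S) \<and> fan (Suc k) (f ` ?f ` S) g' T' \<and> T' \<noteq> {}
      \<and> (c / 8 - 1 / 4) * card T' \<le> card (edges (g' ` f ` ?f ` S) T')"
      using dense R by (intro less.hyps[OF _ contr(1) _ \<phi> _ \<open>c > 2\<close>]) simp_all
    then obtain f g' T' where *: "contr f (?f ` S)" "fan (Suc k) (f ` ?f ` S) g' T'"
      "T' \<noteq> {}" "(c / 8 - 1 / 4) * card T' \<le> card (edges (g' ` f ` ?f ` S) T')"
      by (elim exE conjE)
    have "contr ?f S"
      using \<psi> s fan by (intro contr_proj) (auto simp: fan_def additive_def)
    then have "contr (f \<circ> ?f) S" using *(1) by (rule contr_comp)
    then show ?thesis using *(2-4) unfolding image_comp[of f ?f] by blast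
  next
    case False
    then have stuck: "card (edges (proj \<psi> e ` ?R) (proj \<psi> e ` T)) < c * card (proj \<psi> e ` T)"
      if "e \<in> ?R" "e \<noteq> 0" "additive \<psi>" "\<psi> e = (1::bit)" "p \<in> T" "p + e \<in> T" for e \<psi> p
      using that not_le by blast
    obtain e X where e: "e \<noteq> 0" and X: "X \<subseteq> T" "X \<noteq> {}" "e \<notin> X" "\<And>q. q \<in> X \<Longrightarrow> q + e \<in> ?R \<union> T"
      and dense: "\<And>\<psi>. \<lbrakk>additive \<psi>; \<psi> e = (1::bit)\<rbrakk> \<Longrightarrow> (c / 8 - 1 / 4) * card (proj \<psi> e ` X)
        \<le> card (edges (proj \<psi> e ` ?R) (proj \<psi> e ` X))"
    proof (rule dense_link[OF finT less.prems(2) \<phi> _ less.prems(4) \<open>c > 2\<close> less.prems(6) stuck])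
    qed simp_all
    obtain \<psi> where \<psi>: "additive \<psi>" "\<psi> e = (1::bit)" using nonzero_functional[OF e] .
    have "fan (Suc k) S (proj \<psi> e \<circ> g) (proj \<psi> e ` X)"
      using X fan_image[OF fan] by (intro fan_extend[OF fan \<psi> e]) auto
    then have "fan (Suc k) (id ` S) (proj \<psi> e \<circ> g) (proj \<psi> e ` X)" by simp
    moreover have "card (edges (proj \<psi> e ` ?R) (proj \<psi> e ` X))
        \<le> card (edges ((proj \<psi> e \<circ> g) ` S) (proj \<psi> e ` X))"
      using finite_subset[OF X(1) finT] by (intro card_mono finite_edges edges_mono) auto
    then have "(c / 8 - 1 / 4) * card (proj \<psi> e ` X)
        \<le> card (edges ((proj \<psi> e \<circ> g) ` id ` S) (proj \<psi> e ` X))"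
      using dense[OF \<psi>] by simp
    moreover have "proj \<psi> e ` X \<noteq> {}" using X(2) by simp
    ultimately show ?thesis using contr_id[of S] by blast
  qed
qed

text \<open>The random hyperplane reduces \<open>c\<close> to \<open>c / 4\<close>, and the
  separated step reduces this to \<open>c / 32 - 1 / 4\<close>, which is at least
  \<open>c / 64\<close> when \<open>c \<ge> 16\<close>.\<close>

lemma fan_step:
  fixes c :: real
  assumes fan: "fan k S g T" and T: "T \<noteq> {}" and c: "c \<ge> 16"
    and dense: "c * card T \<le> card (edges (g ` S) T)"
  obtains f g' T' where "contr f S" "fan (Suc k) (f ` S) g' T'" "T' \<noteq> {}"
    "c / 64 * card T' \<le> card (edges (g' ` f ` S) T')"
proof -
  have finT: "finite T" "0 \<notin> T" using fan by (auto simp: fan_def)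
  obtain \<phi> where \<phi>: "additive \<phi>"
    "card (edges (g ` S) T) \<le> 4 * card (edges {r \<in> g ` S. \<phi> r = (0::bit)} {q \<in> T. \<phi> q = 1})"
    using bipartition_by_functional[OF finT] .
  let ?T = "{q \<in> T. \<phi> q = 1}"
  have fan': "fan k S g ?T" using fan by (rule fan_subset) blast
  have le: "c * card T \<le> 4 * card (edges {r \<in> g ` S. \<phi> r = 0} ?T)"
    using dense \<phi>(2) by linarith
  moreover have "0 < c * card T" using c T finT by (simp add: card_gt_0_iff)
  ultimately have "?T \<noteq> {}" by (intro notI) (simp add: edges_def)
  moreover have "c * card ?T \<le> c * card T" using c finT by (simp add: card_mono)
  then have "c / 4 * card ?T \<le> card (edges {r \<in> g ` S. \<phi> r = 0} ?T)" using le by simp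
  ultimately have "\<exists>f g' T'. contr f S \<and> fan (Suc k) (f ` S) g' T' \<and> T' \<noteq> {}
      \<and> (c / 4 / 8 - 1 / 4) * card T' \<le> card (edges (g' ` f ` S) T')"
    using c by (intro fan_step_separated[OF fan' _ \<phi>(1)]) simp_all
  then obtain f g' T' where *: "contr f S" "fan (Suc k) (f ` S) g' T'" "T' \<noteq> {}"
      "(c / 4 / 8 - 1 / 4) * card T' \<le> card (edges (g' ` f ` S) T')"
    by (elim exE conjE)
  have "c / 64 * card T' \<le> (c / 4 / 8 - 1 / 4) * card T'" using c by (intro mult_right_mono) auto
  then show thesis using that *(1-3) *(4) by (meson order_trans)
qed

text \<open>Every round costs a factor of 64. The degree bound before the last round is
  \<open>64 * c\<close>, large enough for \<open>fan_step\<close> because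
  \<open>c \<ge> 1\<close>.\<close>

lemma fan_iterate:
  fixes c :: real
  assumes S: "finite S" and T: "T \<subseteq> S" "0 \<notin> T" "T \<noteq> {}" and c: "c \<ge> 1"
    and dense: "64 ^ k * c * card T \<le> card (edges S T)"
  shows "\<exists>f g' T'. contr f S \<and> fan k (f ` S) g' T' \<and> T' \<noteq> {}
    \<and> c * card T' \<le> card (edges (g' ` f ` S) T')"
  using c dense
proof (induction k arbitrary: c)
  case 0
  then have "contr id S" "fan 0 (id ` S) id T" "T \<noteq> {}"
    "c * card T \<le> card (edges (id ` id ` S) T)"
    using fan_0[OF S T(1,2)] T contr_id[of S] by simp_all
  then show ?case by blast
next
  case (Suc k)
  have "64 * c \<ge> 1" "64 ^ k * (64 * c) * card T \<le> card (edges S T)"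
    using Suc.prems by (simp_all add: algebra_simps)
  from Suc.IH[OF this] obtain f g' T' where *: "contr f S" "fan k (f ` S) g' T'" "T' \<noteq> {}"
    "64 * c * card T' \<le> card (edges (g' ` f ` S) T')" by blast
  obtain f2 g2 T2 where **: "contr f2 (f ` S)" "fan (Suc k) (f2 ` f ` S) g2 T2" "T2 \<noteq> {}"
    "64 * c / 64 * card T2 \<le> card (edges (g2 ` f2 ` f ` S) T2)"
    using fan_step[OF *(2,3) _ *(4)] Suc.prems by auto
  have "contr (f2 \<circ> f) S" using *(1) **(1) by (rule contr_comp)
  moreover have "c * card T2 \<le> card (edges (g2 ` f2 ` f ` S) T2)" using **(4) by simp
  ultimately show ?case using **(2,3) unfolding image_comp[of f2 f] by blast
qed

section \<open>Cycles in complete graphs\<close>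

text \<open>A path that cannot be prolonged at its first vertex closes up to a cycle there.\<close>

lemma cycle_if_no_leaf:
  assumes fin: "finite (\<Union>Y)" and e: "{a, b} \<in> Y" "a \<noteq> b"
    and no_leaf: "\<And>v u. \<lbrakk>{v, u} \<in> Y; v \<noteq> u\<rbrakk> \<Longrightarrow> \<exists>u'. u' \<noteq> u \<and> u' \<noteq> v \<and> {v, u'} \<in> Y"
  shows "\<exists>Z\<subseteq>Y. is_cycle Z"
proof -
  let ?path = "\<lambda>vs. distinct vs \<and> set vs \<subseteq> \<Union>Y \<and> length vs \<ge> 2
    \<and> (\<forall>i. Suc i < length vs \<longrightarrow> {vs ! i, vs ! Suc i} \<in> Y)"
  have "?path [a, b]" using e by (auto simp: less_Suc_eq)
  moreover have "length vs < Suc (card (\<Union>Y))" if "?path vs" for vs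
    using that card_mono[OF fin, of "set vs"] distinct_card[of vs] by simp
  ultimately obtain vs where vs: "?path vs" and max: "\<And>xs. ?path xs \<Longrightarrow> length xs \<le> length vs"
    using ex_has_greatest_nat[of ?path "[a, b]" length "Suc (card (\<Union>Y))"] by blast
  let ?v = "vs ! 0" and ?u = "vs ! 1"
  have len: "length vs \<ge> 2" "vs \<noteq> []" using vs by auto
  have "{?v, ?u} \<in> Y" using vs len by (metis One_nat_def Suc_1 Suc_le_lessD)
  moreover have "?v \<noteq> ?u" using vs len by (simp add: nth_eq_iff_index_eq)
  ultimately obtain u' where u': "u' \<noteq> ?u" "u' \<noteq> ?v" "{?v, u'} \<in> Y" using no_leaf by blast
  have "u' \<in> set vs"
  proof (rule ccontr)
    assume "u' \<notin> set vs"
    have "?path (u' # vs)"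
    proof (intro conjI allI impI)
      show "distinct (u' # vs)" "set (u' # vs) \<subseteq> \<Union>Y" "2 \<le> length (u' # vs)"
        using vs \<open>u' \<notin> set vs\<close> u' by auto
      fix i assume "Suc i < length (u' # vs)"
      then show "{(u' # vs) ! i, (u' # vs) ! Suc i} \<in> Y"
        using vs u'(3) by (cases i) (auto simp: insert_commute)
    qed
    from max[OF this] show False by simp
  qed
  then obtain j where j: "j < length vs" "u' = vs ! j" by (auto simp: in_set_conv_nth)
  have "j \<noteq> 0" "j \<noteq> 1" using u' j by metis+
  then have j2: "j \<ge> 2" by simp
  let ?ws = "take (Suc j) vs"
  have lw: "length ?ws = Suc j" using j by simp
  have "cycle_edges ?ws \<subseteq> Y"
  proof
    fix \<epsilon> assume "\<epsilon> \<in> cycle_edges ?ws"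
    then obtain i where i: "i < Suc j" "\<epsilon> = {?ws ! i, ?ws ! (Suc i mod Suc j)}"
      unfolding cycle_edges_def lw by blast
    show "\<epsilon> \<in> Y"
    proof (cases "i = j")
      case True
      then show ?thesis using i u'(3) j by (simp add: insert_commute)
    next
      case False
      then show ?thesis using i j vs by simp
    qed
  qed
  moreover have "is_cycle (cycle_edges ?ws)"
    unfolding is_cycle_def using vs lw j2 by (intro exI[of _ ?ws]) simp
  ultimately show ?thesis by blast
qed

text \<open>Two indices with the same edge would be successors of each other, which is impossible on
  a cycle of length at least three.\<close>

lemma inj_cycle_edges:
  assumes "distinct vs" "length vs \<ge> 3"
  shows "inj_on (\<lambda>i. {vs ! i, vs ! (Suc i mod length vs)}) {..<length vs}"
proof (rule inj_onI)
  let ?n = "length vs"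
  fix i j assume ij: "i \<in> {..<?n}" "j \<in> {..<?n}"
    and eq: "{vs ! i, vs ! (Suc i mod ?n)} = {vs ! j, vs ! (Suc j mod ?n)}"
  have lt: "Suc i mod ?n < ?n" "Suc j mod ?n < ?n"
    by (rule mod_less_divisor, use assms(2) in linarith)+
  have "i = j \<or> i = Suc j mod ?n \<and> Suc i mod ?n = j"
    using eq ij lt assms(1) by (auto simp: doubleton_eq_iff nth_eq_iff_index_eq)
  moreover have "\<not> (i = Suc j mod ?n \<and> Suc i mod ?n = j)"
    using ij assms(2) by (cases "Suc j = ?n"; cases "Suc i = ?n") auto
  ultimately show "i = j" by blast
qed

text \<open>The sum splits into the sum over all vertices and its cyclic shift, which
  cancel.\<close>

lemma sum_cycle_edges:
  fixes w :: "'v \<Rightarrow> vec"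
  assumes "distinct vs" "length vs \<ge> 3"
  shows "(\<Sum>\<epsilon>\<in>cycle_edges vs. \<Sum>v\<in>\<epsilon>. w v) = 0"
proof -
  let ?n = "length vs"
  let ?s = "\<lambda>i. Suc i mod ?n"
  have n: "?n > 0" using assms(2) by linarith
  have "bij_betw ?s {..<?n} {..<?n}"
    by (rule bij_betw_byWitness[where f' = "\<lambda>i. if i = 0 then ?n - 1 else i - 1"])
      (use n in \<open>auto simp: mod_Suc\<close>)
  then have shift: "(\<Sum>i<?n. w (vs ! ?s i)) = (\<Sum>i<?n. w (vs ! i))"
    by (rule sum.reindex_bij_betw)
  have "cycle_edges vs = (\<lambda>i. {vs ! i, vs ! ?s i}) ` {..<?n}"
    unfolding cycle_edges_def by auto
  then have "(\<Sum>\<epsilon>\<in>cycle_edges vs. \<Sum>v\<in>\<epsilon>. w v) = (\<Sum>i<?n. \<Sum>v\<in>{vs ! i, vs ! ?s i}. w v)"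
    using inj_cycle_edges[OF assms] by (simp add: sum.reindex)
  also have "\<dots> = (\<Sum>i<?n. w (vs ! i) + w (vs ! ?s i))"
  proof (rule sum.cong)
    fix i assume "i \<in> {..<?n}"
    moreover have "?s i \<noteq> i" using \<open>i \<in> _\<close> assms(2) by (cases "Suc i = ?n") auto
    ultimately have "vs ! i \<noteq> vs ! ?s i" using assms n by (simp add: nth_eq_iff_index_eq)
    then show "(\<Sum>v\<in>{vs ! i, vs ! ?s i}. w v) = w (vs ! i) + w (vs ! ?s i)" by simp
  qed simp
  also have "\<dots> = 0" by (simp add: sum.distrib shift)
  finally show ?thesis .
qed

text \<open>Affine combinations over GF(2) have an odd number of terms, so an affine dependence is a
  non-empty subset of even size with sum zero. This suits edge vectors \<open>w u + w v\<close>,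
  which see only differences.\<close>

definition affinely_independent :: "nat \<Rightarrow> (nat \<Rightarrow> vec) \<Rightarrow> bool" where
  "affinely_independent t w \<longleftrightarrow> (\<forall>Y\<subseteq>{..<t}. even (card Y) \<longrightarrow> (\<Sum>i\<in>Y. w i) = 0 \<longrightarrow> Y = {})"

text \<open>After interchanging the sums, \<open>w v\<close> occurs once for each edge at
  \<open>v\<close>, so only the parity of the degree matters. The second claim is the handshake
  lemma.\<close>

lemma sum_edges_by_degree:
  fixes w :: "nat \<Rightarrow> vec"
  assumes Y: "Y \<subseteq> complete_graph_edges t"
  defines "deg \<equiv> \<lambda>v. card {\<epsilon> \<in> Y. v \<in> \<epsilon>}"
  shows "(\<Sum>\<epsilon>\<in>Y. \<Sum>v\<in>\<epsilon>. w v) = (\<Sum>v | v < t \<and> odd (deg v). w v)"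
    and "even (card {v. v < t \<and> odd (deg v)})"
proof -
  have fY: "finite Y"
    by (rule finite_subset[of _ "Pow {..<t}"]) (use Y in \<open>auto simp: complete_graph_edges_def\<close>)
  have \<epsilon>: "\<epsilon> \<subseteq> {..<t}" "card \<epsilon> = 2" if "\<epsilon> \<in> Y" for \<epsilon>
    using that Y by (auto simp: complete_graph_edges_def)
  have "(\<Sum>\<epsilon>\<in>Y. \<Sum>v\<in>\<epsilon>. w v) = (\<Sum>\<epsilon>\<in>Y. \<Sum>v | v \<in> {..<t} \<and> v \<in> \<epsilon>. w v)"
  proof (rule sum.cong)
    fix \<epsilon> assume "\<epsilon> \<in> Y"
    then have "\<epsilon> = {v. v \<in> {..<t} \<and> v \<in> \<epsilon>}" using \<epsilon>(1) by blast
    then show "(\<Sum>v\<in>\<epsilon>. w v) = (\<Sum>v | v \<in> {..<t} \<and> v \<in> \<epsilon>. w v)" by simp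
  qed simp
  also have "\<dots> = (\<Sum>v\<in>{..<t}. \<Sum>\<epsilon> | \<epsilon> \<in> Y \<and> v \<in> \<epsilon>. w v)"
    using fY by (intro sum.swap_restrict) auto
  also have "\<dots> = (\<Sum>v\<in>{..<t}. if odd (deg v) then w v else 0)"
  proof (rule sum.cong)
    fix v
    have "(\<Sum>\<epsilon>\<in>A. x :: vec) = (if even (card A) then 0 else x)" if "finite A" for A :: "nat set set" and x
      using that by (induction A rule: finite_induct) auto
    then show "(\<Sum>\<epsilon> | \<epsilon> \<in> Y \<and> v \<in> \<epsilon>. w v) = (if odd (deg v) then w v else 0)"
      using fY by (simp add: deg_def)
  qed simp
  also have "\<dots> = (\<Sum>v | v < t \<and> odd (deg v). w v)"
    by (simp add: sum.If_cases Int_def)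
  finally show "(\<Sum>\<epsilon>\<in>Y. \<Sum>v\<in>\<epsilon>. w v) = (\<Sum>v | v < t \<and> odd (deg v). w v)" .
  have "(\<Sum>v\<in>{..<t}. deg v) = (\<Sum>v\<in>{..<t}. \<Sum>\<epsilon> | \<epsilon> \<in> Y \<and> v \<in> \<epsilon>. 1)"
    by (simp add: deg_def)
  also have "\<dots> = (\<Sum>\<epsilon>\<in>Y. \<Sum>v | v \<in> {..<t} \<and> v \<in> \<epsilon>. 1)"
    using fY by (intro sum.swap_restrict[symmetric]) auto
  also have "\<dots> = (\<Sum>\<epsilon>\<in>Y. card \<epsilon>)"
  proof (rule sum.cong)
    fix \<epsilon> assume "\<epsilon> \<in> Y"
    then have "{v. v \<in> {..<t} \<and> v \<in> \<epsilon>} = \<epsilon>" using \<epsilon>(1) by blast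
    then show "(\<Sum>v | v \<in> {..<t} \<and> v \<in> \<epsilon>. 1) = card \<epsilon>" by simp
  qed simp
  also have "\<dots> = 2 * card Y" using \<epsilon>(2) by simp
  finally have "even (\<Sum>v\<in>{..<t}. deg v)" by simp
  then show "even (card {v. v < t \<and> odd (deg v)})"
    by (simp add: even_sum_iff conj_commute)
qed

text \<open>By affine independence, edge vectors sum to zero only if all degrees are even. A
  non-empty such edge set has no leaf and hence contains a cycle; conversely, cycles sum to
  zero.\<close>

lemma vindep_edges_iff_acyclic:
  assumes w: "affinely_independent t w" and X: "X \<subseteq> complete_graph_edges t"
  shows "vindep (\<lambda>\<epsilon>. \<Sum>v\<in>\<epsilon>. w v) X \<longleftrightarrow> X \<in> indep (cycle_matroid (complete_graph_edges t))"
proof -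
  have "\<exists>Z\<subseteq>X. is_cycle Z" if dep: "\<not> vindep (\<lambda>\<epsilon>. \<Sum>v\<in>\<epsilon>. w v) X"
  proof -
    obtain Y where Y: "Y \<subseteq> X" "Y \<noteq> {}" "(\<Sum>\<epsilon>\<in>Y. \<Sum>v\<in>\<epsilon>. w v) = 0"
      using dep unfolding vindep_def by blast
    then have YE: "Y \<subseteq> complete_graph_edges t" using X by blast
    let ?odd = "{v. v < t \<and> odd (card {\<epsilon> \<in> Y. v \<in> \<epsilon>})}"
    have "?odd = {}"
    proof (rule w[unfolded affinely_independent_def, rule_format])
      show "(\<Sum>v\<in>?odd. w v) = 0" using sum_edges_by_degree(1)[OF YE, of w] Y(3) by simp
    qed (use sum_edges_by_degree(2)[OF YE] in auto)
    then have even: "even (card {\<epsilon> \<in> Y. v \<in> \<epsilon>})" if "v < t" for v using that by blast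
    have vt: "v < t" if "\<epsilon> \<in> Y" "v \<in> \<epsilon>" for \<epsilon> v
      using that YE by (auto simp: complete_graph_edges_def)
    have fU: "finite (\<Union>Y)" by (rule finite_subset[of _ "{..<t}"]) (use vt in auto)
    obtain a b where ab: "{a, b} \<in> Y" "a \<noteq> b"
      using Y(2) YE unfolding complete_graph_edges_def by blast
    have "\<exists>u'. u' \<noteq> u \<and> u' \<noteq> v \<and> {v, u'} \<in> Y" if vu: "{v, u} \<in> Y" "v \<noteq> u" for v u
    proof -
      have "v < t" by (rule vt[OF vu(1)]) simp
      then have "{\<epsilon> \<in> Y. v \<in> \<epsilon>} \<noteq> {{v, u}}" using even by force
      then obtain \<epsilon> where \<epsilon>: "\<epsilon> \<in> Y" "v \<in> \<epsilon>" "\<epsilon> \<noteq> {v, u}" using vu by blast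
      then obtain x y where "\<epsilon> = {x, y}" "x \<noteq> y" using YE unfolding complete_graph_edges_def by blast
      then show ?thesis using \<epsilon> by (metis insert_commute insertE singletonD)
    qed
    then have "\<exists>Z\<subseteq>Y. is_cycle Z" using cycle_if_no_leaf[OF fU ab] by blast
    then show ?thesis using Y(1) by blast
  qed
  moreover have "\<not> vindep (\<lambda>\<epsilon>. \<Sum>v\<in>\<epsilon>. w v) X" if "is_cycle Z" "Z \<subseteq> X" for Z
  proof -
    obtain vs where vs: "distinct vs" "length vs \<ge> 3" "Z = cycle_edges vs"
      using \<open>is_cycle Z\<close> unfolding is_cycle_def by blast
    then have "Z \<noteq> {}" by (force simp: cycle_edges_def)
    then show ?thesis
      using sum_cycle_edges[OF vs(1,2), of w] vs(3) that(2) unfolding vindep_def by blast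
  qed
  ultimately show ?thesis using X by (auto simp: cycle_matroid_def)
qed

section \<open>Clique minors\<close>

text \<open>Outside the pairs \<open>x\<close>, \<open>x + e\<close> the projection is injective,
  and there only \<open>e\<close> itself is sent to 0.\<close>

lemma card_proj_ge:
  fixes T :: "vec set"
  assumes fin: "finite T" and \<psi>: "additive \<psi>" "\<psi> e = 1" and nT: "0 \<notin> T"
  shows "card T \<le> card (proj \<psi> e ` T - {0}) + 1 + card {x \<in> T. x + e \<in> T}"
proof -
  let ?D = "{x \<in> T. x + e \<in> T}"
  have "inj_on (proj \<psi> e) (T - insert e ?D)"
    by (auto simp: inj_on_def proj_eq_iff[OF \<psi>] add.assoc)
  moreover have "proj \<psi> e ` (T - insert e ?D) \<subseteq> proj \<psi> e ` T - {0}"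
    using nT by (auto simp: proj_eq_0_iff[OF \<psi>])
  ultimately have "card (T - insert e ?D) \<le> card (proj \<psi> e ` T - {0})"
    using fin by (intro card_inj_on_le) auto
  moreover have "card T \<le> card ((T - insert e ?D) \<union> insert e ?D)"
    by (rule card_mono) (use fin in auto)
  moreover have "\<dots> \<le> card (T - insert e ?D) + card (insert e ?D)" by (rule card_Un_le)
  moreover have "card (insert e ?D) \<le> 1 + card ?D" using fin by (simp add: card_insert_if)
  ultimately show ?thesis by linarith
qed

text \<open>Contracting an element of degree below \<open>c - 1\<close> loses fewer than
  \<open>c\<close> non-zero vectors and lowers the rank bound by one, so more than
  \<open>c * r\<close> of them remain. In rank 0 there would be none, so the process stops
  earlier.\<close>

lemma contract_to_locally_dense:
  fixes c :: real
  assumes "finite S" "S \<subseteq> vspan B" "finite B" "card B \<le> r" "c * r < card (S - {0})" "c \<ge> 1"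
  shows "\<exists>f. contr f S \<and> f ` S - {0} \<noteq> {}
    \<and> (\<forall>e\<in>f ` S - {0}. c - 1 \<le> card {x \<in> f ` S - {0}. x + e \<in> f ` S - {0}})"
  using assms
proof (induction r arbitrary: S B)
  case 0
  then have "S - {0} = {}" by auto
  then have "card (S - {0}) = 0" by (simp only: card.empty)
  with 0(5) show ?case by simp
next
  case (Suc r)
  let ?deg = "\<lambda>e. card {x \<in> S - {0}. x + e \<in> S - {0}}"
  show ?case
  proof (cases "\<forall>e\<in>S - {0}. c - 1 \<le> ?deg e")
    case True
    have "0 \<le> c * Suc r" using Suc.prems(6) by simp
    then have "0 < card (S - {0})" using Suc.prems(5) by linarith
    then have "S - {0} \<noteq> {}" by (intro notI) simp
    then have "contr id S \<and> id ` S - {0} \<noteq> {}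
      \<and> (\<forall>e\<in>id ` S - {0}. c - 1 \<le> card {x \<in> id ` S - {0}. x + e \<in> id ` S - {0}})"
      using True contr_id[of S] by (simp only: image_id id_apply) blast
    then show ?thesis by blast
  next
    case False
    then obtain e where e: "e \<in> S" "e \<noteq> 0" "?deg e < c - 1" by force
    obtain \<psi> where \<psi>: "additive \<psi>" "\<psi> e = (1::bit)" using nonzero_functional[OF e(2)] .
    let ?\<pi> = "proj \<psi> e"
    have a: "additive ?\<pi>" using \<psi>(1) by (rule additive_proj)
    have \<pi>e: "?\<pi> e = 0" by (simp add: proj_eq_0_iff[OF \<psi>])
    have "e \<in> vspan ((\<lambda>x. x) ` B)" using e Suc.prems by auto
    then obtain Y where Y: "Y \<subseteq> B" "e = (\<Sum>y\<in>Y. y)"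
      using vspan_image_sum[OF Suc.prems(3)] by metis
    \<comment> \<open>Modulo \<open>e\<close>, the member \<open>b\<close> of an expansion of
      \<open>e\<close> is the sum of the others and can be removed from the spanning set.\<close>
    then obtain b where b: "b \<in> Y" using e(2) by fastforce
    have "finite Y" using Y Suc.prems finite_subset by blast
    have "0 = (\<Sum>y\<in>Y. ?\<pi> y)"
      using arg_cong[OF Y(2), of ?\<pi>] \<pi>e additive.sum[OF a, of "\<lambda>y. y" Y] by simp
    then have "0 = ?\<pi> b + (\<Sum>y\<in>Y - {b}. ?\<pi> y)"
      using b \<open>finite Y\<close> by (simp add: sum.remove)
    then have \<pi>b: "?\<pi> b = (\<Sum>y\<in>Y - {b}. ?\<pi> y)" by (metis vec_add_eq_0_iff)
    let ?B = "?\<pi> ` (B - {b})"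
    have "?\<pi> b \<in> vspan ?B"
      unfolding \<pi>b using Y by (intro sum_in_vspan vspan_base) auto
    then have "?\<pi> ` B \<subseteq> vspan ?B" by (auto intro: vspan_base)
    then have "vspan (?\<pi> ` B) \<subseteq> vspan ?B" by (rule vspan_least)
    then have "?\<pi> ` S \<subseteq> vspan ?B"
      using additive_vspan[OF a, of _ B] Suc.prems(2) by blast
    moreover have "card ?B \<le> r"
      using Suc.prems(3,4) b Y card_image_le[of "B - {b}" ?\<pi>] by (auto simp: card_Diff_singleton)
    moreover have "card (S - {0}) \<le> card (?\<pi> ` (S - {0}) - {0}) + 1 + ?deg e"
      using Suc.prems(1) by (intro card_proj_ge \<psi>) auto
    moreover have "?\<pi> ` (S - {0}) - {0} = ?\<pi> ` S - {0}"
      using additive.zero[OF a] by auto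
    ultimately have "c * r < card (?\<pi> ` S - {0})" "?\<pi> ` S \<subseteq> vspan ?B" "card ?B \<le> r"
      using Suc.prems(5) e(3) by (simp_all add: algebra_simps)
    then have "\<exists>f. contr f (?\<pi> ` S) \<and> f ` ?\<pi> ` S - {0} \<noteq> {}
      \<and> (\<forall>e\<in>f ` ?\<pi> ` S - {0}. c - 1 \<le> card {x \<in> f ` ?\<pi> ` S - {0}. x + e \<in> f ` ?\<pi> ` S - {0}})"
      using Suc.prems by (intro Suc.IH[of _ ?B]) auto
    then obtain f where f: "contr f (?\<pi> ` S)" "f ` ?\<pi> ` S - {0} \<noteq> {}"
      "\<forall>e\<in>f ` ?\<pi> ` S - {0}. c - 1 \<le> card {x \<in> f ` ?\<pi> ` S - {0}. x + e \<in> f ` ?\<pi> ` S - {0}}"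
      by (elim exE conjE)
    have "contr (f \<circ> ?\<pi>) S" using contr_proj[OF \<psi> e(1)] f(1) by (rule contr_comp)
    then show ?thesis using f(2,3) unfolding image_comp[of f ?\<pi>] by blast
  qed
qed

section \<open>Extracting a clique from a large fan\<close>

lemma vindep_subset_of_card:
  assumes "finite Q" "2 ^ m \<le> card Q"
  shows "\<exists>P\<subseteq>Q. card P = m \<and> vindep (\<lambda>x. x) P"
  using assms(2)
proof (induction m)
  case 0
  show ?case by (rule exI[of _ "{}"]) (simp add: vindep_def)
next
  case (Suc m)
  then obtain P where P: "P \<subseteq> Q" "card P = m" "vindep (\<lambda>x. x) P" by auto
  then have fP: "finite P" using assms(1) finite_subset by blast
  \<comment> \<open>Greedy choice: \<open>m\<close> vectors span at most \<open>2 ^ m\<close>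
    vectors, too few to cover \<open>Q\<close>.\<close>
  have "\<not> Q \<subseteq> vspan P"
  proof
    assume "Q \<subseteq> vspan P"
    then have "card Q \<le> 2 ^ m"
      using finite_card_vspan[OF fP] P(2) by (meson card_mono order_trans)
    moreover have "(2::nat) ^ m < 2 ^ Suc m" by simp
    ultimately show False using Suc.prems by linarith
  qed
  then obtain q where q: "q \<in> Q" "q \<notin> vspan P" by blast
  then have "q \<notin> P" using vspan_base by blast
  then show ?case
    using P q fP by (intro exI[of _ "insert q P"] conjI vindep_insert) simp_all
qed

lemma pigeonhole_power:
  assumes "finite T" "finite A" "F ` T \<subseteq> A" "card A \<le> a" "a * b \<le> card T" "b > 0" "T \<noteq> {}"
  obtains y where "b \<le> card {q \<in> T. F q = y}"
proof -
  have "\<exists>y. b \<le> card {q \<in> T. F q = y}"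
  proof (rule ccontr)
    assume "\<not> ?thesis"
    then have lt: "card {q \<in> T. F q = y} \<le> b - 1" for y by (metis Suc_pred' assms(6) not_le not_less_eq_eq)
    have "T = (\<Union>y\<in>A. {q \<in> T. F q = y})" using assms(3) by blast
    then have "card T \<le> (\<Sum>y\<in>A. card {q \<in> T. F q = y})" using card_UN_le[OF assms(2)] by metis
    also have "\<dots> \<le> card A * (b - 1)" using sum_bounded_above[OF lt] by simp
    also have "\<dots> \<le> a * (b - 1)" using assms(4) by simp
    finally have le: "a * b \<le> a * (b - 1)" by (rule order_trans[OF assms(5)])
    have "card A > 0" using assms(2,3,7) by (auto simp: card_gt_0_iff)
    then have "a > 0" using assms(4) by simp
    then have "a * (b - 1) < a * b" using assms(6) by simp
    then show False using le by simp
  qed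
  then show thesis using that by blast
qed

lemma finite_complete_graph_edges: "finite (complete_graph_edges t)"
  by (rule finite_subset[of _ "Pow {..<t}"]) (auto simp: complete_graph_edges_def)

text \<open>The kernel has at most \<open>(2 ^ k) ^ k\<close> subsets of size \<open>k\<close>, so
  \<open>2 ^ card ?E\<close> vertices share one of them, \<open>D0\<close>. Among these vertices
  there are enough independent ones to assign one to each edge.\<close>

lemma fan_clique:
  assumes fan: "fan k S g T"
    and card: "2 ^ (k * k) * 2 ^ card (complete_graph_edges (Suc k)) \<le> card T"
  obtains h w where "contr h S" "affinely_independent (Suc k) w"
    "\<And>u v. \<lbrakk>u \<le> k; v \<le> k; u \<noteq> v\<rbrakk> \<Longrightarrow> w u + w v \<in> h ` S"
proof -
  let ?K = "{x. g x = 0}"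
  let ?E = "complete_graph_edges (Suc k)"
  have g: "additive g" and finT: "finite T" and K: "finite ?K" "card ?K \<le> 2 ^ k"
    using fan unfolding fan_def by blast+
  have "\<forall>q\<in>T. \<exists>l D. l \<in> S \<and> g l = q \<and> D \<subseteq> ?K \<and> card D = k \<and> vindep (\<lambda>x. x) D \<and> (\<forall>d\<in>D. l + d \<in> S)"
    using fan unfolding fan_def by blast
  then obtain l D where lD: "\<And>q. q \<in> T \<Longrightarrow> l q \<in> S \<and> g (l q) = q \<and> D q \<subseteq> ?K \<and> card (D q) = k
      \<and> vindep (\<lambda>x. x) (D q) \<and> (\<forall>d\<in>D q. l q + d \<in> S)"
    by metis
  have "0 < card T" using card by (rule order_less_le_trans[rotated]) simp
  then have T: "T \<noteq> {}" by (intro notI) simp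
  then obtain q where "q \<in> T" by blast
  then have kK: "k \<le> card ?K" using lD K(1) card_mono by metis
  have "card {X. X \<subseteq> ?K \<and> card X = k} = card ?K choose k" using K(1) by (rule n_subsets)
  also have "\<dots> \<le> card ?K ^ k" using kK by (rule binomial_le_pow)
  also have "\<dots> \<le> (2 ^ k) ^ k" using K(2) by (rule power_mono) simp
  finally have cA: "card {X. X \<subseteq> ?K \<and> card X = k} \<le> 2 ^ (k * k)" by (simp add: power_mult)
  have fA: "finite {X. X \<subseteq> ?K \<and> card X = k}"
    by (rule finite_subset[of _ "Pow ?K"]) (use K in auto)
  have "D ` T \<subseteq> {X. X \<subseteq> ?K \<and> card X = k}" using lD by blast
  from pigeonhole_power[OF finT fA this cA card _ T]
  obtain D0 where D0: "2 ^ card ?E \<le> card {q \<in> T. D q = D0}" by auto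
  have "finite {q \<in> T. D q = D0}" using finT by simp
  from vindep_subset_of_card[OF this D0]
  obtain P where P: "P \<subseteq> {q \<in> T. D q = D0}" "card P = card ?E" "vindep (\<lambda>x. x) P"
    by (elim exE conjE)
  have finP: "finite P" using finite_subset[OF P(1)] finT by simp
  obtain \<beta> where \<beta>: "bij_betw \<beta> ?E P"
    using finite_same_card_bij[OF finite_complete_graph_edges finP] P(2) by auto
  have "{q \<in> T. D q = D0} \<noteq> {}" using D0 by (intro notI) simp
  then have D0': "D0 \<subseteq> ?K" "card D0 = k" "vindep (\<lambda>x. x) D0" using lD by blast+
  then have "finite D0" using K finite_subset by blast
  then obtain d where d: "bij_betw d {1..k} D0"
    using finite_same_card_bij[of "{1..k}" D0] D0'(2) by auto
  \<comment> \<open>Index 0 stands for the preimage \<open>l\<close> itself and the other indices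
    for its translates by \<open>D0\<close>, which makes \<open>k + 1\<close> points.\<close>
  define w where "w i = (if i = 0 then 0 else d i)" for i
  have wD: "w i = 0 \<or> w i \<in> D0" if "i \<le> k" for i
    using that bij_betwE[OF d] by (auto simp: w_def)
  have gw: "g (w i) = 0" if "i \<le> k" for i
    using wD[OF that] D0'(1) additive.zero[OF g] by auto
  have lw: "l (\<beta> \<epsilon>) + w i \<in> S" if "\<epsilon> \<in> ?E" "i \<le> k" for \<epsilon> i
  proof -
    have "\<beta> \<epsilon> \<in> T" "D (\<beta> \<epsilon>) = D0" using bij_betwE[OF \<beta>] that(1) P(1) by blast+
    then show ?thesis using lD[of "\<beta> \<epsilon>"] wD[OF that(2)] by auto
  qed
  \<comment> \<open>The preimage to be contracted for the edge; taking the smaller end is an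
    arbitrary choice.\<close>
  define x where "x \<epsilon> = l (\<beta> \<epsilon>) + w (Min \<epsilon>)" for \<epsilon>
  have Min: "Min \<epsilon> \<le> k" if "\<epsilon> \<in> ?E" for \<epsilon>
    using that by (auto simp: complete_graph_edges_def min_def)
  have "x ` ?E \<subseteq> S" using lw Min by (auto simp: x_def)
  then obtain h where h: "contr h S" "\<And>y. h y = 0 \<longleftrightarrow> y \<in> vspan (x ` ?E)"
    using contr_kernel[of "x ` ?E" S] finite_complete_graph_edges by blast
  then have ah: "additive h" by (simp add: contr_def)
  show thesis
  proof (rule that[of h "\<lambda>i. h (w i)"])
    show "contr h S" by (rule h)
    show "affinely_independent (Suc k) (\<lambda>i. h (w i))"
      unfolding affinely_independent_def
    proof (intro allI impI)
      fix Y assume Y: "Y \<subseteq> {..<Suc k}" "even (card Y)" "(\<Sum>i\<in>Y. h (w i)) = 0"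
      have Yk: "i \<le> k" if "i \<in> Y" for i using that Y(1) by auto
      let ?y = "\<Sum>i\<in>Y. w i"
      have "h ?y = 0" using Y(3) by (simp add: additive.sum[OF ah])
      then have "?y \<in> vspan (x ` ?E)" by (simp add: h(2))
      then obtain E' where E': "E' \<subseteq> ?E" "?y = (\<Sum>\<epsilon>\<in>E'. x \<epsilon>)"
        using vspan_image_sum[OF finite_complete_graph_edges] by metis
      have gx: "g (x \<epsilon>) = \<beta> \<epsilon>" if "\<epsilon> \<in> E'" for \<epsilon>
      proof -
        have "\<epsilon> \<in> ?E" using that E' by blast
        then have "\<beta> \<epsilon> \<in> T" using bij_betwE[OF \<beta>] P(1) by blast
        then show ?thesis
          using lD[of "\<beta> \<epsilon>"] gw[OF Min[OF \<open>\<epsilon> \<in> ?E\<close>]] by (simp add: x_def additive.add[OF g])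
      qed
      \<comment> \<open>Applying \<open>g\<close> removes the \<open>w i\<close> and leaves the
        vertices assigned to \<open>E'\<close>, whose independence forces \<open>E'\<close> to be
        empty. What remains is a relation inside \<open>D0\<close>.\<close>
      have "0 = g ?y" using gw Yk by (simp add: additive.sum[OF g])
      also have "\<dots> = (\<Sum>\<epsilon>\<in>E'. \<beta> \<epsilon>)" unfolding E'(2) using gx by (simp add: additive.sum[OF g])
      also have "\<dots> = (\<Sum>p\<in>\<beta> ` E'. p)"
        using inj_on_subset[OF bij_betw_imp_inj_on[OF \<beta>] E'(1)] by (simp add: sum.reindex)
      finally have "\<beta> ` E' = {}"
        using P(3) E'(1) bij_betw_imp_surj_on[OF \<beta>] unfolding vindep_def by (metis image_mono)
      then have "?y = 0" using E'(2) by simp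
      moreover have "?y = (\<Sum>i\<in>Y - {0}. d i)"
        using Y(1) finite_subset[of Y] by (intro sum.mono_neutral_cong_right) (auto simp: w_def)
      moreover have Y0: "Y - {0} \<subseteq> {1..k}" using Yk by force
      ultimately have "(\<Sum>p\<in>d ` (Y - {0}). p) = 0"
        using inj_on_subset[OF bij_betw_imp_inj_on[OF d] Y0] by (simp add: sum.reindex)
      then have "d ` (Y - {0}) = {}"
        using D0'(3) Y0 bij_betw_imp_surj_on[OF d] unfolding vindep_def by (metis image_mono)
      then have "Y = {} \<or> Y = {0}" by auto
      \<comment> \<open>As \<open>w 0 = 0\<close>, the set \<open>{0}\<close> has sum zero; it is
        excluded by parity.\<close>
      then show "Y = {}" using Y(2) by auto
    qed
    fix u v :: nat assume uv: "u \<le> k" "v \<le> k" "u \<noteq> v"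
    let ?\<epsilon> = "{u, v}"
    have "u < Suc k" "v < Suc k" using uv by simp_all
    then have \<epsilon>: "?\<epsilon> \<in> ?E" using uv(3) unfolding complete_graph_edges_def by blast
    \<comment> \<open>The common summand cancels. One of the two terms is the contracted
      \<open>h (x ?\<epsilon>) = 0\<close>, so the other one is the required vector.\<close>
    have sum: "h (w u) + h (w v) = h (l (\<beta> ?\<epsilon>) + w u) + h (l (\<beta> ?\<epsilon>) + w v)"
      by (simp add: add_ac flip: additive.add[OF ah])
    have "h (x ?\<epsilon>) = 0" using \<epsilon> by (simp add: h(2) vspan_base)
    moreover have "Min ?\<epsilon> = u \<or> Min ?\<epsilon> = v" by (simp add: min_def)
    ultimately have "h (l (\<beta> ?\<epsilon>) + w u) = 0 \<or> h (l (\<beta> ?\<epsilon>) + w v) = 0"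
      unfolding x_def by metis
    then have "h (w u) + h (w v) = h (l (\<beta> ?\<epsilon>) + w u) \<or> h (w u) + h (w v) = h (l (\<beta> ?\<epsilon>) + w v)"
      unfolding sum by auto
    then show "h (w u) + h (w v) \<in> h ` S" using lw[OF \<epsilon>] uv by auto
  qed
qed

section \<open>Matroids represented by vectors\<close>

lemma coeff_sum_monom: "coeff (\<Sum>i<m. monom (a i) i) j = (if j < m then a j else 0)"
  by (auto simp: coeff_sum if_distrib cong: if_cong)

text \<open>A coefficient function over GF(2) is the indicator of its support, and a column becomes
  the polynomial with its entries as coefficients.\<close>

lemma columns_independent_iff_vindep:
  fixes A :: "nat \<Rightarrow> 'a \<Rightarrow> bit"
  assumes "finite X"
  shows "columns_independent m A X \<longleftrightarrow> vindep (\<lambda>e. \<Sum>i<m. monom (A i e) i) X"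
proof -
  let ?v = "\<lambda>e. \<Sum>i<m. monom (A i e) i"
  have zero: "(\<Sum>e\<in>Y. ?v e) = 0 \<longleftrightarrow> (\<forall>i<m. (\<Sum>e\<in>Y. A i e) = 0)" for Y
  proof -
    have "coeff (\<Sum>e\<in>Y. ?v e) j = (if j < m then (\<Sum>e\<in>Y. A j e) else 0)" for j
      by (simp add: coeff_sum[of _ Y] coeff_sum_monom)
    then show ?thesis unfolding poly_eq_iff by auto
  qed
  have split: "(\<Sum>e\<in>X. c e * A i e) = (\<Sum>e | e \<in> X \<and> c e = 1. A i e)" for c i
  proof -
    have "(\<Sum>e\<in>X. c e * A i e) = (\<Sum>e\<in>X. if c e = 1 then A i e else 0)"
    proof (rule sum.cong)
      fix e show "c e * A i e = (if c e = 1 then A i e else 0)" by (cases "c e") auto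
    qed simp
    also have "\<dots> = (\<Sum>e | e \<in> X \<and> c e = 1. A i e)"
      using assms by (simp add: sum.If_cases Int_def)
    finally show ?thesis .
  qed
  show ?thesis
  proof
    assume L: "columns_independent m A X"
    show "vindep ?v X"
      unfolding vindep_def
    proof (intro allI impI)
      fix Y assume Y: "Y \<subseteq> X" "(\<Sum>e\<in>Y. ?v e) = 0"
      let ?c = "\<lambda>e. if e \<in> Y then 1 else (0::bit)"
      have "{e. e \<in> X \<and> ?c e = 1} = Y" using Y(1) by auto
      then have "(\<Sum>e\<in>X. ?c e * A i e) = (\<Sum>e\<in>Y. A i e)" for i
        unfolding split by simp
      then have "\<forall>e\<in>X. ?c e = 0"
        using L Y(2) unfolding columns_independent_def zero by presburger
      then show "Y = {}" using Y(1) by (auto split: if_splits)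
    qed
  next
    assume R: "vindep ?v X"
    show "columns_independent m A X"
      unfolding columns_independent_def split
    proof (intro allI impI ballI)
      fix c :: "'a \<Rightarrow> bit" and e
      assume "\<forall>i<m. (\<Sum>e | e \<in> X \<and> c e = 1. A i e) = 0" and e: "e \<in> X"
      then have "{e. e \<in> X \<and> c e = 1} = {}"
        using R unfolding vindep_def zero by (metis (no_types, lifting) mem_Collect_eq subsetI)
      then show "c e = 0" using e by (cases "c e") auto
    qed
  qed
qed

definition represents :: "('a \<Rightarrow> vec) \<Rightarrow> 'a indep_system \<Rightarrow> bool" where
  "represents v M \<longleftrightarrow> (\<forall>X\<subseteq>ground M. X \<in> indep M \<longleftrightarrow> vindep v X)"

lemma binary_matroid_represents:
  assumes "matroid M" "binary_matroid M"
  obtains v where "represents v M"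
proof -
  interpret matroid M by fact
  obtain m A where A: "\<forall>X\<subseteq>ground M. X \<in> indep M \<longleftrightarrow> columns_independent m A X"
    using assms(2) unfolding binary_matroid_def by blast
  then have "represents (\<lambda>e. \<Sum>i<m. monom (A i e) i) M"
    unfolding represents_def
    using columns_independent_iff_vindep[OF finite_subset[OF _ finite_ground]] by blast
  then show thesis by (rule that)
qed

text \<open>A zero vector would give a circuit of size one, two equal non-zero vectors a circuit of
  size two.\<close>

lemma simple_represents:
  assumes M: "matroid M" "simple_matroid M" and v: "represents v M"
  shows "inj_on v (ground M)" "0 \<notin> v ` ground M"
proof -
  interpret matroid M by fact
  have nz: "v a \<noteq> 0" if a: "a \<in> ground M" for a
  proof
    assume "v a = 0"
    then have "\<not> vindep v {a}" unfolding vindep_def by (intro notI) (auto dest!: spec[of _ "{a}"])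
    then have "{a} \<notin> indep M" using v a by (simp add: represents_def)
    moreover have "Y = {}" if "Y \<subset> {a}" for Y using that by blast
    ultimately have "circuit M {a}" using a indep_empty by (auto simp: circuit_def)
    then have "card {a} \<noteq> 1" using M(2) unfolding simple_matroid_def by blast
    then show False by simp
  qed
  then show "0 \<notin> v ` ground M" by force
  have single: "{a} \<in> indep M" if "a \<in> ground M" for a
  proof -
    have "vindep v {a}" using nz[OF that] by (auto simp: vindep_def subset_singleton_iff)
    then show ?thesis using v that by (simp add: represents_def)
  qed
  show "inj_on v (ground M)"
  proof (rule inj_onI, rule ccontr)
    fix a b assume ab: "a \<in> ground M" "b \<in> ground M" "v a = v b" "a \<noteq> b"
    then have "(\<Sum>x\<in>{a, b}. v x) = 0" by simp
    then have "\<not> vindep v {a, b}" unfolding vindep_def by blast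
    then have "{a, b} \<notin> indep M" using v ab by (simp add: represents_def)
    moreover have "Y = {} \<or> Y = {a} \<or> Y = {b}" if "Y \<subset> {a, b}" for Y using that by blast
    ultimately have "circuit M {a, b}"
      using ab indep_empty single by (auto simp: circuit_def)
    then have "card {a, b} \<noteq> 2" using M(2) unfolding simple_matroid_def by blast
    then show False using ab by simp
  qed
qed

lemma maximal_vindep_subset:
  assumes "finite Z"
  obtains C where "C \<subseteq> Z" "vindep v C" "v ` Z \<subseteq> vspan (v ` C)"
proof -
  let ?A = "{C. C \<subseteq> Z \<and> vindep v C}"
  have fA: "finite ?A" by (rule finite_subset[of _ "Pow Z"]) (use assms in auto)
  have "{} \<in> ?A" by (simp add: vindep_def)
  then have "?A \<noteq> {}" by blast
  from finite_has_maximal[OF fA this]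
  obtain C where C: "C \<in> ?A" "\<forall>B\<in>?A. C \<subseteq> B \<longrightarrow> C = B" by (elim bexE)
  have fC: "finite C" using C(1) assms finite_subset by blast
  have "v a \<in> vspan (v ` C)" if a: "a \<in> Z" for a
  proof (rule ccontr)
    assume n: "v a \<notin> vspan (v ` C)"
    then have "insert a C \<in> ?A" using C(1) a vindep_insert[OF fC] by blast
    then have "a \<in> C" using C(2) by blast
    then show False using n vspan_base by blast
  qed
  then show thesis using that C(1) by blast
qed

lemma card_le_mrank:
  assumes "matroid M" "X \<in> indep M" shows "card X \<le> mrank M"
proof -
  interpret matroid M by fact
  have "finite (indep M)"
    by (rule finite_subset[of _ "Pow (ground M)"]) (use indep_subset_ground finite_ground in auto)
  then show ?thesis using assms(2) unfolding mrank_def by simp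
qed

lemma represents_vspan:
  assumes M: "matroid M" and v: "represents v M"
  obtains B where "finite B" "card B \<le> mrank M" "v ` ground M \<subseteq> vspan B"
proof -
  interpret matroid M by fact
  obtain C where C: "C \<subseteq> ground M" "vindep v C" "v ` ground M \<subseteq> vspan (v ` C)"
    using maximal_vindep_subset[OF finite_ground] by blast
  then have "C \<in> indep M" using v by (simp add: represents_def)
  then have "card C \<le> mrank M" by (rule card_le_mrank[OF M])
  moreover have fC: "finite C" using C(1) finite_ground finite_subset by blast
  ultimately have "card (v ` C) \<le> mrank M" using card_image_le[OF fC, of v] by simp
  then show thesis using that[of "v ` C"] fC C(3) by blast
qed

section \<open>Minors from linear maps\<close>

lemma vindep_reindex:
  assumes "inj_on x X" shows "vindep v (x ` X) \<longleftrightarrow> vindep (v \<circ> x) X"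
proof -
  have "(\<Sum>y\<in>x ` Y. v y) = (\<Sum>y\<in>Y. (v \<circ> x) y)" if "Y \<subseteq> X" for Y
    using inj_on_subset[OF assms that] by (rule sum.reindex)
  moreover have "(\<forall>Z\<subseteq>x ` X. P Z) \<longleftrightarrow> (\<forall>Y\<subseteq>X. P (x ` Y))" for P
    unfolding subset_image_iff by blast
  ultimately show ?thesis unfolding vindep_def by simp
qed

text \<open>A sum over \<open>X\<close> killed by \<open>f\<close> equals a sum over a subset of
  \<open>C\<close>, and together they form a dependence in \<open>X \<union> C\<close>. Conversely,
  applying \<open>f\<close> to a dependence removes its part in \<open>C\<close>.\<close>

lemma vindep_contract:
  assumes f: "additive f" and kernel: "\<And>x. f x = 0 \<Longrightarrow> x \<in> vspan (v ` C)"
    and C: "finite C" "vindep v C" "\<And>a. a \<in> C \<Longrightarrow> f (v a) = 0"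
    and X: "finite X" "X \<inter> C = {}"
  shows "vindep v (X \<union> C) \<longleftrightarrow> vindep (\<lambda>a. f (v a)) X"
proof
  assume L: "vindep v (X \<union> C)"
  show "vindep (\<lambda>a. f (v a)) X"
    unfolding vindep_def
  proof (intro allI impI)
    fix Y assume Y: "Y \<subseteq> X" "(\<Sum>a\<in>Y. f (v a)) = 0"
    then have "(\<Sum>a\<in>Y. v a) \<in> vspan (v ` C)" by (intro kernel) (simp add: additive.sum[OF f])
    then obtain Y' where Y': "Y' \<subseteq> C" "(\<Sum>a\<in>Y. v a) = (\<Sum>a\<in>Y'. v a)"
      using vspan_image_sum[OF C(1)] by metis
    have "(\<Sum>a\<in>Y \<union> Y'. v a) = (\<Sum>a\<in>Y. v a) + (\<Sum>a\<in>Y'. v a)"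
      using Y(1) Y'(1) X C(1) by (intro sum.union_disjoint) (auto dest: finite_subset)
    then have "(\<Sum>a\<in>Y \<union> Y'. v a) = 0" using Y'(2) by simp
    moreover have "Y \<union> Y' \<subseteq> X \<union> C" using Y Y' by blast
    ultimately show "Y = {}" using L unfolding vindep_def by blast
  qed
next
  assume R: "vindep (\<lambda>a. f (v a)) X"
  show "vindep v (X \<union> C)"
    unfolding vindep_def
  proof (intro allI impI)
    fix Y assume Y: "Y \<subseteq> X \<union> C" "(\<Sum>a\<in>Y. v a) = 0"
    have "finite Y" using Y(1) X C finite_subset by blast
    have "0 = (\<Sum>a\<in>Y. f (v a))"
      using Y(2) additive.zero[OF f] by (simp flip: additive.sum[OF f])
    also have "\<dots> = (\<Sum>a\<in>Y \<inter> X. f (v a))"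
      using \<open>finite Y\<close> Y(1) C(3) by (intro sum.mono_neutral_right) auto
    finally have "Y \<inter> X = {}" using R unfolding vindep_def by simp
    then have "Y \<subseteq> C" using Y(1) by blast
    then show "Y = {}" using C(2) Y(2) unfolding vindep_def by blast
  qed
qed

text \<open>Each edge is assigned an element of \<open>M\<close> whose image under \<open>f\<close>
  is the edge vector. Contracting a basis of the elements killed by \<open>f\<close> then turns
  independence in the minor into independence of edge vectors.\<close>

lemma clique_minor:
  assumes M: "matroid M" and v: "represents v M" and f: "contr f (v ` ground M)"
    and w: "affinely_independent t w"
    and clique: "\<And>i j. \<lbrakk>i < t; j < t; i \<noteq> j\<rbrakk> \<Longrightarrow> w i + w j \<in> f ` v ` ground M"
  shows "has_minor M (cycle_matroid (complete_graph_edges t))"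
proof -
  interpret matroid M by fact
  let ?E = "complete_graph_edges t"
  let ?w = "\<lambda>\<epsilon>. \<Sum>i\<in>\<epsilon>. w i"
  have af: "additive f" using f by (simp add: contr_def)
  have "\<exists>a\<in>ground M. f (v a) = ?w \<epsilon>" if "\<epsilon> \<in> ?E" for \<epsilon>
  proof -
    obtain i j where ij: "i < t" "j < t" "i \<noteq> j" "\<epsilon> = {i, j}"
      using \<open>\<epsilon> \<in> ?E\<close> unfolding complete_graph_edges_def by blast
    then show ?thesis using clique[OF ij(1-3)] by auto
  qed
  then obtain x where x: "\<And>\<epsilon>. \<epsilon> \<in> ?E \<Longrightarrow> x \<epsilon> \<in> ground M \<and> f (v (x \<epsilon>)) = ?w \<epsilon>" by metis
  \<comment> \<open>Cycles have at least three edges. Applied to one and two edges, this shows that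
    edge vectors are non-zero and distinct.\<close>
  have indep_small: "vindep ?w X" if X: "X \<subseteq> ?E" "card X \<le> 2" for X
  proof -
    have "\<not> Z \<subseteq> X" if Z: "is_cycle Z" for Z
    proof
      assume "Z \<subseteq> X"
      obtain vs where vs: "distinct vs" "length vs \<ge> 3" "Z = cycle_edges vs"
        using Z unfolding is_cycle_def by blast
      have "Z = (\<lambda>i. {vs ! i, vs ! (Suc i mod length vs)}) ` {..<length vs}"
        unfolding vs(3) cycle_edges_def by auto
      then have "card Z = length vs" using inj_cycle_edges[OF vs(1,2)] by (simp add: card_image)
      moreover have "finite X" using X(1) finite_complete_graph_edges finite_subset by blast
      then have "card Z \<le> card X" using \<open>Z \<subseteq> X\<close> by (rule card_mono)
      ultimately show False using X(2) vs(2) by linarith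
    qed
    then have "X \<in> indep (cycle_matroid ?E)" using X(1) by (auto simp: cycle_matroid_def)
    then show ?thesis using vindep_edges_iff_acyclic[OF w X(1)] by blast
  qed
  have inj: "inj_on x ?E"
  proof (rule inj_onI, rule ccontr)
    fix \<epsilon> \<epsilon>' assume \<epsilon>: "\<epsilon> \<in> ?E" "\<epsilon>' \<in> ?E" "x \<epsilon> = x \<epsilon>'" "\<epsilon> \<noteq> \<epsilon>'"
    then have "?w \<epsilon> = ?w \<epsilon>'" using x by metis
    then have "(\<Sum>\<delta>\<in>{\<epsilon>, \<epsilon>'}. ?w \<delta>) = 0" using \<epsilon>(4) by simp
    moreover have "vindep ?w {\<epsilon>, \<epsilon>'}" using \<epsilon> by (intro indep_small) auto
    ultimately show False unfolding vindep_def by blast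
  qed
  let ?Z = "{a \<in> ground M. f (v a) = 0}"
  let ?K = "x ` ?E"
  have KZ: "?K \<inter> ?Z = {}"
  proof -
    have "?w \<epsilon> \<noteq> 0" if "\<epsilon> \<in> ?E" for \<epsilon>
    proof
      assume "?w \<epsilon> = 0"
      then have "(\<Sum>\<delta>\<in>{\<epsilon>}. ?w \<delta>) = 0" by simp
      moreover have "vindep ?w {\<epsilon>}" using that by (intro indep_small) auto
      ultimately show False unfolding vindep_def by blast
    qed
    then show ?thesis using x by auto
  qed
  have "finite ?Z" using finite_ground by simp
  \<comment> \<open>Only an independent \<open>C\<close> is contracted, so that its sole basis is
    \<open>C\<close>; the rest of \<open>?Z\<close> is deleted.\<close>
  then obtain C where C: "C \<subseteq> ?Z" "vindep v C" "v ` ?Z \<subseteq> vspan (v ` C)"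
    by (rule maximal_vindep_subset)
  have Cg: "C \<subseteq> ground M" and Kg: "?K \<subseteq> ground M" and KC: "?K \<inter> C = {}"
    using C(1) x KZ by auto
  have fC: "finite C" using Cg finite_ground finite_subset by blast
  have Ci: "C \<in> indep M" using C(2) Cg v by (simp add: represents_def)
  then have basis: "basis_of M C B \<longleftrightarrow> B = C" for B by (auto simp: basis_of_def)
  let ?D = "ground M - C - ?K"
  let ?N = "delete (contract M C) ?D"
  have ground_N: "ground ?N = ?K" using Kg KC by (auto simp: delete_def contract_def)
  have indep_N: "X \<in> indep ?N \<longleftrightarrow> X \<union> C \<in> indep M" if "X \<subseteq> ?K" for X
    using that Kg KC by (auto simp: delete_def contract_def basis)
  have kernel: "y \<in> vspan (v ` C)" if "f y = 0" for y
  proof -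
    have "y \<in> vspan {s \<in> v ` ground M. f s = 0}" using f that by (simp add: contr_def)
    also have "{s \<in> v ` ground M. f s = 0} = v ` ?Z" by auto
    also have "vspan (v ` ?Z) \<subseteq> vspan (v ` C)" using C(3) by (rule vspan_least)
    finally show ?thesis .
  qed
  have iso: "x ` X \<in> indep ?N \<longleftrightarrow> X \<in> indep (cycle_matroid ?E)" if X: "X \<subseteq> ?E" for X
  proof -
    have "x ` X \<subseteq> ?K" using X by blast
    then have "x ` X \<in> indep ?N \<longleftrightarrow> vindep v (x ` X \<union> C)"
      using indep_N v Kg Cg by (simp add: represents_def)
    also have "\<dots> \<longleftrightarrow> vindep (\<lambda>a. f (v a)) (x ` X)"
      using X KC C(1) finite_subset[OF X finite_complete_graph_edges]
      by (intro vindep_contract[OF af kernel fC C(2)]) auto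
    also have "\<dots> \<longleftrightarrow> vindep ((\<lambda>a. f (v a)) \<circ> x) X"
      by (rule vindep_reindex[OF inj_on_subset[OF inj X]])
    also have "\<dots> \<longleftrightarrow> vindep ?w X"
    proof -
      have "(\<Sum>\<epsilon>\<in>Y. ((\<lambda>a. f (v a)) \<circ> x) \<epsilon>) = (\<Sum>\<epsilon>\<in>Y. ?w \<epsilon>)" if "Y \<subseteq> X" for Y
        by (rule sum.cong) (use that X x in auto)
      then show ?thesis unfolding vindep_def by auto
    qed
    also have "\<dots> \<longleftrightarrow> X \<in> indep (cycle_matroid ?E)" by (rule vindep_edges_iff_acyclic[OF w X])
    finally show ?thesis .
  qed
  have "isomorphic ?N (cycle_matroid ?E)"
    unfolding isomorphic_def
  proof (intro exI[of _ "inv_into ?E x"] conjI allI impI)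
    show "bij_betw (inv_into ?E x) (ground ?N) (ground (cycle_matroid ?E))"
      unfolding ground_N using inj by (simp add: cycle_matroid_def bij_betw_inv_into inj_on_imp_bij_betw)
    fix X assume "X \<subseteq> ground ?N"
    then have X: "X \<subseteq> ?K" unfolding ground_N .
    then have "inv_into ?E x ` X \<subseteq> ?E" by (auto intro: inv_into_into)
    moreover have "x ` inv_into ?E x ` X = X" using X by (rule image_inv_into_cancel[OF refl])
    ultimately show "X \<in> indep ?N \<longleftrightarrow> inv_into ?E x ` X \<in> indep (cycle_matroid ?E)"
      using iso by metis
  qed
  then show ?thesis
    unfolding has_minor_def using Cg by (intro exI[of _ C] exI[of _ ?D]) auto
qed

section \<open>Constants and conclusion\<close>

lemma card_complete_graph_edges: "card (complete_graph_edges t) = t choose 2"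
proof -
  have "complete_graph_edges t = {X. X \<subseteq> {..<t} \<and> card X = 2}"
    unfolding complete_graph_edges_def by (auto simp: card_2_iff)
  then show ?thesis using n_subsets[of "{..<t}" 2] by simp
qed

text \<open>The factor \<open>64 ^ k\<close> lost in \<open>k\<close> rounds contributes
  \<open>6 * k\<close>, and \<open>fan_clique\<close> requires the remaining terms. Twice the sum is
  \<open>3 * k * k + 13 * k\<close>.\<close>

lemma exponent_bound:
  assumes "k > 0"
  shows "2 ^ (6 * k + (k * k + (Suc k choose 2))) \<le> 2 powr (real (Suc k) ^ 4 / 2)"
proof -
  have "2 * (Suc k choose 2) = Suc k * k" by (simp add: choose_two)
  moreover have "3 * k * k + 13 * k \<le> Suc k ^ 4"
  proof -
    have "k \<le> k * k * k" "k \<le> k * k" "k * k \<le> k * k * k * k" using assms by simp_all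
    \<comment> \<open>For \<open>k = 1\<close> both sides are 16; otherwise
      \<open>4 * k \<le> k * k * k\<close> leaves enough room.\<close>
    then have "3 * k * k + 13 * k \<le> k * k * k * k + 4 * (k * k * k) + 6 * (k * k) + 4 * k + 1"
    proof (cases "k = 1")
      case False
      then have "2 * 2 \<le> k * k" using assms by (intro mult_le_mono) auto
      then have "4 * k \<le> k * k * k" by simp
      then show ?thesis by linarith
    qed simp
    also have "\<dots> = Suc k ^ 4" by (simp add: algebra_simps numeral_eq_Suc)
    finally show ?thesis .
  qed
  ultimately have "2 * (6 * k + (k * k + (Suc k choose 2))) \<le> Suc k ^ 4" by simp
  then have "real (2 * (6 * k + (k * k + (Suc k choose 2)))) \<le> real (Suc k ^ 4)" by (rule of_nat_mono)
  then have "real (6 * k + (k * k + (Suc k choose 2))) \<le> real (Suc k) ^ 4 / 2" by simp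
  then have "2 powr real (6 * k + (k * k + (Suc k choose 2))) \<le> 2 powr (real (Suc k) ^ 4 / 2)"
    by (rule powr_mono) simp
  then show ?thesis by (simp only: powr_realpow zero_less_numeral)
qed

lemma dense_clique:
  fixes S :: "vec set"
  assumes S: "finite S" "S \<subseteq> vspan B" "0 \<notin> S" and B: "finite B" "card B \<le> n"
    and k: "k > 0" and dense: "2 powr (real (Suc k) ^ 4 / 2) * n < card S"
  obtains f w where "contr f S" "affinely_independent (Suc k) w"
    "\<And>u v. \<lbrakk>u \<le> k; v \<le> k; u \<noteq> v\<rbrakk> \<Longrightarrow> w u + w v \<in> f ` S"
proof -
  define C where "C = 2 powr (real (Suc k) ^ 4 / 2)"
  define N where "N = k * k + (Suc k choose 2)"
  define c where "c = (C - 1) / 64 ^ k"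
  have "C \<ge> 1" unfolding C_def by (rule ge_one_powr_ge_zero) simp_all
  moreover have "S - {0} = S" using S(3) by simp
  ultimately obtain f where f: "contr f S" "f ` S - {0} \<noteq> {}"
    and deg: "\<forall>e\<in>f ` S - {0}. C - 1 \<le> card {x \<in> f ` S - {0}. x + e \<in> f ` S - {0}}"
    using contract_to_locally_dense[OF S(1,2) B, of C] dense unfolding C_def by auto
  let ?S = "f ` S"
  let ?T = "?S - {0}"
  let ?N = "\<lambda>e. {x \<in> ?T. x + e \<in> ?T}"
  have fS: "finite ?S" using S(1) by simp
  have "(C - 1) * card ?T = (\<Sum>e\<in>?T. C - 1)" by simp
  also have "\<dots> \<le> (\<Sum>e\<in>?T. real (card (?N e)))" using deg by (intro sum_mono) blast
  also have "\<dots> = card (Sigma ?T ?N)" using fS by simp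
  also have "\<dots> \<le> card (edges ?S ?T)"
  proof (rule of_nat_mono, rule card_inj_on_le)
    let ?g = "\<lambda>(e, x). (x, x + e)"
    show "inj_on ?g (Sigma ?T ?N)" by (auto simp: inj_on_def)
    show "?g ` Sigma ?T ?N \<subseteq> edges ?S ?T"
    proof (rule image_subsetI)
      fix y assume "y \<in> Sigma ?T ?N"
      then obtain e x where "y = (e, x)" "e \<in> ?S" "e \<noteq> 0" "x \<in> ?T" "x + e \<in> ?T" by blast
      moreover from this(3) have "x \<noteq> x + e" by simp
      ultimately show "?g y \<in> edges ?S ?T" by (simp add: edges_def)
    qed
    show "finite (edges ?S ?T)" using fS by (simp add: finite_edges)
  qed
  finally have dense': "64 ^ k * c * card ?T \<le> card (edges ?S ?T)" by (simp add: c_def)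
  have C: "64 ^ k * 2 ^ N \<le> C"
    using exponent_bound[OF k] unfolding C_def N_def by (simp add: power_add power_mult)
  \<comment> \<open>Since \<open>64 ^ k\<close> exceeds 1, the 1 subtracted in \<open>C - 1\<close>
    costs less than 1 after division by \<open>64 ^ k\<close>, and rounding recovers
    \<open>2 ^ N\<close> below.\<close>
  have "(1::real) < 64 ^ k" using k by (intro one_less_power) auto
  then have "64 ^ k * (2 ^ N - 1) < C - 1" using C by (simp add: algebra_simps)
  then have c: "2 ^ N - 1 < c" by (simp add: c_def field_simps)
  have "N > 0" using k by (simp add: N_def)
  then have "(2::real) ^ 1 \<le> 2 ^ N" by (intro power_increasing) auto
  then have "c \<ge> 1" using c by simp
  then obtain f2 g T where f2: "contr f2 ?S" "fan k (f2 ` ?S) g T" "T \<noteq> {}"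
    "c * card T \<le> card (edges (g ` f2 ` ?S) T)"
    using fan_iterate[OF fS _ _ f(2) _ dense'] by auto
  have finT: "finite T" using f2(2) by (simp add: fan_def)
  \<comment> \<open>A graph of average degree at least \<open>c\<close> has at least
    \<open>c\<close> vertices.\<close>
  have "c * card T \<le> real (card T) * real (card T)"
    using f2(4) card_edges_le[OF finT, of "g ` f2 ` ?S"] by (metis of_nat_le_iff of_nat_mult order_trans)
  then have "c \<le> card T" using f2(3) finT by (simp add: card_gt_0_iff)
  then have "real (2 ^ N) < real (card T + 1)" using c by simp
  then have "2 ^ N \<le> card T" by linarith
  then have "2 ^ (k * k) * 2 ^ card (complete_graph_edges (Suc k)) \<le> card T"
    by (simp add: card_complete_graph_edges N_def power_add)
  then obtain h w where h: "contr h (f2 ` ?S)" "affinely_independent (Suc k) w"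
    "\<And>u v. \<lbrakk>u \<le> k; v \<le> k; u \<noteq> v\<rbrakk> \<Longrightarrow> w u + w v \<in> h ` f2 ` ?S"
    using fan_clique[OF f2(2)] by blast
  show thesis
  proof (rule that[of "h \<circ> (f2 \<circ> f)" w])
    show "contr (h \<circ> (f2 \<circ> f)) S"
      using f(1) f2(1) h(1) by (intro contr_comp) (simp_all add: image_comp)
    fix u v :: nat assume "u \<le> k" "v \<le> k" "u \<noteq> v"
    from h(3)[OF this] show "w u + w v \<in> (h \<circ> (f2 \<circ> f)) ` S" by (simp add: image_comp comp_assoc)
  qed (rule h(2))
qed

theorem theorem1p1:
  fixes M :: "'a indep_system" and t n :: nat
  assumes "t > 0" and "n > 0"
    and "matroid M" and "simple_matroid M" and "binary_matroid M"
    and "mrank M = n"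
    and "\<not> has_minor M (cycle_matroid (complete_graph_edges t))"
  shows "real (card (ground M)) \<le> 2 powr (real t ^ 4 / 2) * real n"
proof (rule ccontr)
  assume "\<not> ?thesis"
  then have dense: "2 powr (real t ^ 4 / 2) * real n < card (ground M)" by simp
  obtain v where v: "represents v M"
    using binary_matroid_represents[OF assms(3,5)] .
  note simple = simple_represents[OF assms(3,4) v]
  obtain B where B: "finite B" "card B \<le> n" "v ` ground M \<subseteq> vspan B"
    using represents_vspan[OF assms(3) v] assms(6) by blast
  obtain k where t: "t = Suc k" using assms(1) gr0_implies_Suc by blast
  have "\<exists>f w. contr f (v ` ground M) \<and> affinely_independent t w
    \<and> (\<forall>i<t. \<forall>j<t. i \<noteq> j \<longrightarrow> w i + w j \<in> f ` v ` ground M)"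
  proof (cases "k = 0")
    case True
    \<comment> \<open>For \<open>t = 1\<close> there are no pairs, and the only non-empty index set
      has odd size.\<close>
    have "affinely_independent t (\<lambda>_. 0)"
      unfolding affinely_independent_def t True by (auto simp: lessThan_Suc subset_singleton_iff)
    then show ?thesis using contr_id t True by blast
  next
    case False
    have "finite (v ` ground M)" using matroid.finite_ground[OF assms(3)] by simp
    moreover have "2 powr (real (Suc k) ^ 4 / 2) * n < card (v ` ground M)"
      using dense simple(1) by (simp add: t card_image)
    ultimately obtain f w where "contr f (v ` ground M)" "affinely_independent (Suc k) w"
      "\<And>i j. \<lbrakk>i \<le> k; j \<le> k; i \<noteq> j\<rbrakk> \<Longrightarrow> w i + w j \<in> f ` v ` ground M"
      using dense_clique[OF _ B(3) simple(2) B(1,2)] False by blast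
    then show ?thesis unfolding t less_Suc_eq_le by blast
  qed
  then have "has_minor M (cycle_matroid (complete_graph_edges t))"
    using clique_minor[OF assms(3) v] by blast
  then show False using assms(7) by blast
qed

end
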